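(* Let $(X,d)$ be a proper and geodesic hyperbolic metric space, $o\in X$, $b>1$ a parameter admitting a visual metric $D=D_{b,o}$ on $\partial X$, and let $G\le\mathrm{Isom}(X)$ be a strongly discrete group of general type with Poincaré exponent $\delta_G$. Let $\mu$ be a nonzero $\delta_G$-quasiconformal measure on the limit set $\Lambda$ of $G$. Then $\mu(\Lambda_{ur})=0$ if and only if $G$ is not quasiconvex-cocompact.
   Context: For a metric space $(X,d)$ let $\langle x|y\rangle_z=\frac12[d(x,z)+d(y,z)-d(x,y)]$. $(X,d)$ is (Gromov) hyperbolic if there is $C\ge 0$ with $\langle x|z\rangle_w\ge\min(\langle x|y\rangle_w,\langle y|z\rangle_w)-C$ for all $x,y,z,w\in X$. It is proper if closed balls are compact. Fix a basepoint $o\in X$. A sequence $(x_n)$ in $X$ is a Gromov sequence if $\langle x_n|x_m\rangle_o\to\infty$ as $n,m\to\infty$; two Gromov sequences are equivalent if $\langle x_n|y_n\rangle_o\to\infty$; the Gromov boundary $\partial X$ is the set of equivalence classes, and isometries of $X$ act on it. For $\xi,\eta\in\partial X$ and $y,z\in X$: $\langle\xi|\eta\rangle_z=\inf\{\liminf_{n,m\to\infty}\langle x_n|y_m\rangle_z:(x_n)\in\xi,(y_m)\in\eta\}$, $\langle\xi|y\rangle_z=\langle y|\xi\rangle_z=\inf\{\liminf_{n\to\infty}\langle x_n|y\rangle_z:(x_n)\in\xi\}$, and the Busemann function is $\mathcal B_\xi(y,z)=\langle z|\xi\rangle_y-\langle y|\xi\rangle_z$. A sequence $(x_n)$ in $X\cup\partial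 X$ converges to $\xi\in\partial X$ iff $\langle x_n|\xi\rangle_o\to\infty$. The parameter $b>1$ is close enough to $1$ that there is a complete metric $D=D_{b,o}$ on $\partial X$ (a visual metric) with $C^{-1}b^{-\langle\xi|\eta\rangle_o}\le D(\xi,\eta)\le Cb^{-\langle\xi|\eta\rangle_o}$ for some constant $C\geq 1$; such a $D$ is fixed. $G\le\mathrm{Isom}(X)$ is strongly discrete if $\{g\in G:d(o,g(o))\le r\}$ is finite for every $r>0$. An isometry $g$ is loxodromic if it has two fixed points $g_+,g_-\in\partial X$ such that for every neighborhood $U$ of $g_-$ the iterates $g^n$ converge to $g_+$ uniformly on $\partial X\setminus U$, and $g^{-1}$ has the same property (with $g_+$ and $g_-$ exchanged). $G$ is of general type if it contains two loxodromic isometries with disjoint fixed-point sets in $\partial X$. $\delta_G=\inf\{s\ge0:\sum_{g\in G}b^{-s\,d(o,g(o))}<\infty\}$ is the Poincaré exponent (finite here, since a $\delta_G$-quasiconformal measure is assumed given). The limit set is $\Lambda=\{\eta\in\partial X:g_n(o)\to\eta\text{ for some sequence }(g_n)\text{ in }G\}$. The uniformly radial limit set $\Lambda_{ur}$ is the set of $\eta\in\partial X$ for which there are $\sigma>0$ and a sequence $(g_n)_1^\infty$ in $G$ with $g_1(o)=o$, $g_n(o)\to\eta$, $\langle o|\eta\rangle_{g_n(o)}\le\sigma$ and $d(g_n(o),g_{n+1}(o))\le\sigma$ for all $n$. For $g\in\mathrm{Isom}(X)$ and $\eta\in\partial X$, $g'(\eta)=b^{\mathcal B_\eta(o,g^{-1}(o))}$.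 Measures are finite and Borel. A measure $\mu$ on $\partial X$ is $s$-quasiconformal if there is $C\ge1$ with $C^{-1}\int_A(g')^s\,d\mu\le\mu(g(A))\le C\int_A(g')^s\,d\mu$ for all $g\in G$ and Borel $A\subset\partial X$. $G$ is quasiconvex-cocompact if $G(o)$ is quasiconvex: there is $\rho>0$ such that for all $x,y\in G(o)$ every geodesic segment from $x$ to $y$ is contained in the $\rho$-neighborhood of $G(o)$. *)

theory Defs
  imports "HOL-Analysis.Analysis" "HOL-Algebra.Group"
begin

section \<open>Hyperbolic metric spaces\<close>

text \<open>The space \<open>X\<close> is the universe of a type of class \<open>metric_space\<close>.\<close>

definition gromov_product :: "'a::metric_space \<Rightarrow> 'a \<Rightarrow> 'a \<Rightarrow> real" where
  "gromov_product z x y = (dist x z + dist y z - dist x y) / 2"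

definition gromov_hyperbolic :: "'a::metric_space itself \<Rightarrow> bool" where
  "gromov_hyperbolic _ \<longleftrightarrow> (\<exists>C\<ge>0. \<forall>x y z w :: 'a.
     gromov_product w x z \<ge> min (gromov_product w x y) (gromov_product w y z) - C)"

definition proper_metric :: "'a::metric_space itself \<Rightarrow> bool" where
  "proper_metric _ \<longleftrightarrow> (\<forall>(x::'a) r. compact (cball x r))"

definition geodesic_segment :: "(real \<Rightarrow> 'a::metric_space) \<Rightarrow> 'a \<Rightarrow> 'a \<Rightarrow> bool" where
  "geodesic_segment \<gamma> x y \<longleftrightarrow> \<gamma> 0 = x \<and> \<gamma> (dist x y) = y \<and>
     (\<forall>s\<in>{0..dist x y}. \<forall>t\<in>{0..dist x y}. dist (\<gamma> s) (\<gamma> t) = \<bar>s - t\<bar>)"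

definition geodesic_metric :: "'a::metric_space itself \<Rightarrow> bool" where
  "geodesic_metric _ \<longleftrightarrow> (\<forall>x y :: 'a. \<exists>\<gamma>. geodesic_segment \<gamma> x y)"


section \<open>The Gromov boundary\<close>

definition gromov_sequences :: "'a::metric_space \<Rightarrow> (nat \<Rightarrow> 'a) set" where
  "gromov_sequences p =
     {x. filterlim (\<lambda>(n, m). gromov_product p (x n) (x m)) at_top (sequentially \<times>\<^sub>F sequentially)}"

definition gromov_equiv :: "'a::metric_space \<Rightarrow> ((nat \<Rightarrow> 'a) \<times> (nat \<Rightarrow> 'a)) set" where
  "gromov_equiv p = {(x, y). x \<in> gromov_sequences p \<and> y \<in> gromov_sequences p \<and>
     filterlim (\<lambda>n. gromov_product p (x n) (y n)) at_top sequentially}"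

type_synonym 'a boundary_point = "(nat \<Rightarrow> 'a) set"

definition gromov_boundary :: "'a::metric_space \<Rightarrow> 'a boundary_point set" where
  "gromov_boundary p = gromov_sequences p // gromov_equiv p"

text \<open>Boundary Gromov products are extended reals, since \<open>\<langle>\<xi>|\<xi>\<rangle>\<^sub>z = \<infinity>\<close>.\<close>

definition boundary_product ::
    "'a::metric_space \<Rightarrow> 'a boundary_point \<Rightarrow> 'a boundary_point \<Rightarrow> ereal" where
  "boundary_product z \<xi> \<eta> = (INF (x, y)\<in>\<xi> \<times> \<eta>.
     Liminf (sequentially \<times>\<^sub>F sequentially) (\<lambda>(n, m). ereal (gromov_product z (x n) (y m))))"

definition point_boundary_product ::
    "'a::metric_space \<Rightarrow> 'a \<Rightarrow> 'a boundary_point \<Rightarrow> ereal" where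
  "point_boundary_product z y \<xi> =
     (INF x\<in>\<xi>. liminf (\<lambda>n. ereal (gromov_product z (x n) y)))"

text \<open>For \<open>\<xi>\<close> in the boundary, \<open>0 \<le> \<langle>y|\<xi>\<rangle>\<^sub>z \<le> d(y, z)\<close>, so the conversions to \<open>real\<close> lose
  nothing.\<close>

definition busemann :: "'a::metric_space boundary_point \<Rightarrow> 'a \<Rightarrow> 'a \<Rightarrow> real" where
  "busemann \<xi> y z = real_of_ereal (point_boundary_product y z \<xi>)
                   - real_of_ereal (point_boundary_product z y \<xi>)"

definition converges_to_boundary ::
    "'a::metric_space \<Rightarrow> (nat \<Rightarrow> 'a) \<Rightarrow> 'a boundary_point \<Rightarrow> bool" where
  "converges_to_boundary p x \<xi> \<longleftrightarrow> (\<lambda>n. point_boundary_product p (x n) \<xi>) \<longlonglongrightarrow> \<infinity>"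

text \<open>\<open>b\<^sup>-\<^sup>t\<close> for an extended real \<open>t > -\<infinity>\<close>, with \<open>b\<^sup>-\<^sup>\<infinity> = 0\<close>.\<close>

definition exp_neg :: "real \<Rightarrow> ereal \<Rightarrow> real" where
  "exp_neg b t = (if t = \<infinity> then 0 else b powr (- real_of_ereal t))"

definition visual_metric ::
    "real \<Rightarrow> 'a::metric_space \<Rightarrow> ('a boundary_point \<Rightarrow> 'a boundary_point \<Rightarrow> real) \<Rightarrow> bool" where
  "visual_metric b p D \<longleftrightarrow>
     Metric_space (gromov_boundary p) D \<and>
     Metric_space.mcomplete (gromov_boundary p) D \<and>
     (\<exists>C\<ge>1. \<forall>\<xi>\<in>gromov_boundary p. \<forall>\<eta>\<in>gromov_boundary p.
        exp_neg b (boundary_product p \<xi> \<eta>) / C \<le> D \<xi> \<eta> \<and>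
        D \<xi> \<eta> \<le> C * exp_neg b (boundary_product p \<xi> \<eta>))"

text \<open>The topology of the boundary is the one given by the visual metric \<open>D\<close>.\<close>

abbreviation boundary_topology ::
    "'a::metric_space \<Rightarrow> ('a boundary_point \<Rightarrow> 'a boundary_point \<Rightarrow> real)
      \<Rightarrow> 'a boundary_point topology" where
  "boundary_topology p D \<equiv> Metric_space.mtopology (gromov_boundary p) D"


section \<open>Isometry groups\<close>

definition isometry_group :: "('a::metric_space \<Rightarrow> 'a) monoid" where
  "isometry_group = \<lparr>carrier = {g. bij g \<and> (\<forall>x y. dist (g x) (g y) = dist x y)},
                     mult = (\<circ>), one = id\<rparr>"

lemma group_isometry_group: "group (isometry_group :: ('a::metric_space \<Rightarrow> 'a) monoid)"
proof (rule groupI)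
  fix g :: "'a \<Rightarrow> 'a" assume g: "g \<in> carrier isometry_group"
  then have b: "bij g" and d: "dist (g x) (g y) = dist x y" for x y
    by (auto simp: isometry_group_def)
  have "dist (inv_into UNIV g x) (inv_into UNIV g y) = dist x y" for x y
    using d[of "inv_into UNIV g x" "inv_into UNIV g y"] b by (simp add: bij_is_surj surj_f_inv_f)
  then have "inv_into UNIV g \<in> carrier isometry_group"
    using b by (auto simp: isometry_group_def bij_imp_bij_inv)
  moreover have "inv_into UNIV g \<otimes>\<^bsub>isometry_group\<^esub> g = \<one>\<^bsub>isometry_group\<^esub>"
    using b by (simp add: isometry_group_def bij_is_inj)
  ultimately show "\<exists>h\<in>carrier isometry_group. h \<otimes>\<^bsub>isometry_group\<^esub> g = \<one>\<^bsub>isometry_group\<^esub>"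
    by blast
qed (auto simp: isometry_group_def bij_comp o_assoc)

definition boundary_action :: "('a \<Rightarrow> 'a) \<Rightarrow> 'a boundary_point \<Rightarrow> 'a boundary_point" where
  "boundary_action g \<xi> = (\<lambda>x. g \<circ> x) ` \<xi>"

definition boundary_fixed_points ::
    "'a::metric_space \<Rightarrow> ('a \<Rightarrow> 'a) \<Rightarrow> 'a boundary_point set" where
  "boundary_fixed_points p g = {\<xi> \<in> gromov_boundary p. boundary_action g \<xi> = \<xi>}"

text \<open>For every neighbourhood \<open>U\<close> of \<open>\<eta>\<close>, the iterates of \<open>g\<close> converge to \<open>\<xi>\<close> uniformly
  off \<open>U\<close>.\<close>

definition attracts_off ::
    "'a::metric_space \<Rightarrow> ('a boundary_point \<Rightarrow> 'a boundary_point \<Rightarrow> real) \<Rightarrow>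
     ('a \<Rightarrow> 'a) \<Rightarrow> 'a boundary_point \<Rightarrow> 'a boundary_point \<Rightarrow> bool" where
  "attracts_off p D g \<xi> \<eta> \<longleftrightarrow>
     (\<forall>U. \<eta> \<in> boundary_topology p D interior_of U \<longrightarrow>
       (\<forall>\<epsilon>>0. \<exists>N. \<forall>n\<ge>N. \<forall>\<zeta>\<in>gromov_boundary p - U. D ((boundary_action g ^^ n) \<zeta>) \<xi> < \<epsilon>))"

definition loxodromic ::
    "'a::metric_space \<Rightarrow> ('a boundary_point \<Rightarrow> 'a boundary_point \<Rightarrow> real) \<Rightarrow> ('a \<Rightarrow> 'a) \<Rightarrow> bool" where
  "loxodromic p D g \<longleftrightarrow> g \<in> carrier isometry_group \<and>
     (\<exists>\<xi>\<in>boundary_fixed_points p g. \<exists>\<eta>\<in>boundary_fixed_points p g. \<xi> \<noteq> \<eta> \<and>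
        attracts_off p D g \<xi> \<eta> \<and> attracts_off p D (inv\<^bsub>isometry_group\<^esub> g) \<eta> \<xi>)"

definition strongly_discrete :: "'a::metric_space \<Rightarrow> ('a \<Rightarrow> 'a) set \<Rightarrow> bool" where
  "strongly_discrete p G \<longleftrightarrow> (\<forall>r>0. finite {g \<in> G. dist p (g p) \<le> r})"

definition general_type ::
    "'a::metric_space \<Rightarrow> ('a boundary_point \<Rightarrow> 'a boundary_point \<Rightarrow> real) \<Rightarrow>
     ('a \<Rightarrow> 'a) set \<Rightarrow> bool" where
  "general_type p D G \<longleftrightarrow> (\<exists>g\<in>G. \<exists>h\<in>G. loxodromic p D g \<and> loxodromic p D h \<and>
     boundary_fixed_points p g \<inter> boundary_fixed_points p h = {})"

definition poincare_exponent ::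
    "real \<Rightarrow> 'a::metric_space \<Rightarrow> ('a \<Rightarrow> 'a) set \<Rightarrow> ereal" where
  "poincare_exponent b p G =
     Inf {ereal s | s. s \<ge> 0 \<and> (\<lambda>g. b powr (- s * dist p (g p))) summable_on G}"

definition limit_set ::
    "'a::metric_space \<Rightarrow> ('a \<Rightarrow> 'a) set \<Rightarrow> 'a boundary_point set" where
  "limit_set p G = {\<eta> \<in> gromov_boundary p. \<exists>g. (\<forall>n::nat. g n \<in> G) \<and>
     converges_to_boundary p (\<lambda>n. g n p) \<eta>}"

definition uniformly_radial_limit_set ::
    "'a::metric_space \<Rightarrow> ('a \<Rightarrow> 'a) set \<Rightarrow> 'a boundary_point set" where
  "uniformly_radial_limit_set p G = {\<eta> \<in> gromov_boundary p. \<exists>\<sigma>>0. \<exists>g.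
     (\<forall>n::nat. g n \<in> G) \<and> g 0 p = p \<and> converges_to_boundary p (\<lambda>n. g n p) \<eta> \<and>
     (\<forall>n. point_boundary_product (g n p) p \<eta> \<le> ereal \<sigma> \<and>
          dist (g n p) (g (Suc n) p) \<le> \<sigma>)}"

definition quasiconvex_cocompact :: "'a::metric_space \<Rightarrow> ('a \<Rightarrow> 'a) set \<Rightarrow> bool" where
  "quasiconvex_cocompact p G \<longleftrightarrow> (\<exists>\<rho>>0. \<forall>x\<in>(\<lambda>g. g p) ` G. \<forall>y\<in>(\<lambda>g. g p) ` G. \<forall>\<gamma>.
     geodesic_segment \<gamma> x y \<longrightarrow> \<gamma> ` {0..dist x y} \<subseteq> (\<Union>z\<in>(\<lambda>g. g p) ` G. ball z \<rho>))"


section \<open>Quasiconformal measures\<close>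

definition conformal_derivative ::
    "real \<Rightarrow> 'a::metric_space \<Rightarrow> ('a \<Rightarrow> 'a) \<Rightarrow> 'a boundary_point \<Rightarrow> real" where
  "conformal_derivative b p g \<eta> = b powr (busemann \<eta> p ((inv\<^bsub>isometry_group\<^esub> g) p))"

definition finite_borel_measure_on :: "'x topology \<Rightarrow> 'x measure \<Rightarrow> bool" where
  "finite_borel_measure_on T \<mu> \<longleftrightarrow>
     finite_measure \<mu> \<and> sets \<mu> = sets (sigma (topspace T) {U. openin T U})"

definition quasiconformal_measure ::
    "real \<Rightarrow> 'a::metric_space \<Rightarrow> ('a \<Rightarrow> 'a) set \<Rightarrow> real \<Rightarrow> 'a boundary_point measure \<Rightarrow> bool" where
  "quasiconformal_measure b p G s \<mu> \<longleftrightarrow> (\<exists>C\<ge>1. \<forall>g\<in>G. \<forall>A\<in>sets \<mu>.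
     ennreal (1 / C) * (\<integral>\<^sup>+\<eta>\<in>A. ennreal (conformal_derivative b p g \<eta> powr s) \<partial>\<mu>)
       \<le> emeasure \<mu> (boundary_action g ` A) \<and>
     emeasure \<mu> (boundary_action g ` A)
       \<le> ennreal C * (\<integral>\<^sup>+\<eta>\<in>A. ennreal (conformal_derivative b p g \<eta> powr s) \<partial>\<mu>))"

end

theory Submission
  imports Defs "HOL-Library.Diagonal_Subsequence"
begin

text \<open>
  If \<open>G(p)\<close> is quasiconvex, geodesics from \<open>p\<close> to \<open>g\<^sub>n(p)\<close> stay near the orbit, so every limit
  point is uniformly radial, and the limit set has full measure.

  Otherwise let \<open>K\<close> be the set of boundary points whose rays stay within a fixed distance of the
  orbit. Some orbit points \<open>p\<close>, \<open>h(p)\<close> are joined by a geodesic making an arbitrarily deep excursion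
  away from the orbit. At each orbit point \<open>g(p)\<close> at height about \<open>n\<close> lying below \<open>K\<close>, a translate of
  this excursion can be spliced in without backtracking, because \<open>G\<close> contains two elements without a
  common fixed point. The boundary points reached through it form a set \<open>B\<^sub>g\<close> whose measure is
  at least a fixed proportion of that of the shadow of \<open>g(p)\<close>. Hence at each height \<open>n\<close> the sets
  \<open>B\<^sub>g\<close> have total measure at least a constant times \<open>\<mu>(K)\<close>. They overlap boundedly often at one
  height, and those at well separated heights are disjoint: a ray into \<open>B\<^sub>g\<close> leaves the orbit right
  after height \<open>n\<close>, while a ray passing over a larger height below \<open>K\<close> follows the orbit until then.
  Since \<open>\<mu>\<close> is finite, \<open>\<mu>(K) = 0\<close>.
\<close>

section \<open>Gromov products\<close>

lemma gromov_product_nonneg: "0 \<le> gromov_product z x y"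
  using dist_triangle[of x y z] by (simp add: gromov_product_def dist_commute)

lemma gromov_product_commute: "gromov_product z x y = gromov_product z y x"
  by (simp add: gromov_product_def dist_commute)

lemma gromov_product_le_dist: "gromov_product z x y \<le> dist x z" "gromov_product z x y \<le> dist y z"
  using dist_triangle[of x z y] dist_triangle[of y z x]
  by (simp_all add: gromov_product_def dist_commute)

lemma gromov_product_add: "gromov_product z x y + gromov_product x z y = dist z x"
  by (simp add: gromov_product_def dist_commute field_simps)

lemma gromov_product_lipschitz_base: "gromov_product z x y \<le> gromov_product w x y + dist z w"
  using dist_triangle[of x z w] dist_triangle[of y z w]
  by (simp add: gromov_product_def dist_commute field_simps)

lemma gromov_product_lipschitz: "gromov_product z x y \<le> gromov_product z w y + dist x w"
  using dist_triangle[of x z w] dist_triangle[of w y x]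
  by (simp add: gromov_product_def dist_commute field_simps)

lemma gromov_product_isometry:
  assumes "\<And>x y. dist (g x) (g y) = dist x y"
  shows "gromov_product (g z) (g x) (g y) = gromov_product z x y"
  by (simp add: gromov_product_def assms)

lemma dist_conv_gromov_product: "dist x y = dist z x + dist z y - 2 * gromov_product z x y"
  by (simp add: gromov_product_def dist_commute field_simps)

lemma gromov_sequences_iff:
  "x \<in> gromov_sequences p \<longleftrightarrow> (\<forall>T. \<exists>N. \<forall>n\<ge>N. \<forall>m\<ge>N. T \<le> gromov_product p (x m) (x n))"
  by (auto simp: gromov_sequences_def filterlim_at_top eventually_prod_sequentially)

lemma gromov_equiv_refl: "x \<in> gromov_sequences p \<Longrightarrow> (x, x) \<in> gromov_equiv p"
  by (fastforce simp: gromov_equiv_def gromov_sequences_iff filterlim_at_top eventually_sequentially)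

lemma gromov_boundary_nonempty: "\<xi> \<in> gromov_boundary p \<Longrightarrow> \<xi> \<noteq> {}"
  using gromov_equiv_refl unfolding gromov_boundary_def quotient_def by fastforce

section \<open>Boundary products and shadows\<close>

lemma point_boundary_product_nonneg: "0 \<le> point_boundary_product z y \<xi>"
  unfolding point_boundary_product_def
  by (intro INF_greatest Liminf_bounded always_eventually) (simp add: gromov_product_nonneg)

text \<open>Since the product is an infimum over representatives, one sequence suffices for an upper
  bound, whereas \<open>point_boundary_product_ge\<close> has to control all of them.\<close>

lemma point_boundary_product_le:
  assumes "w \<in> \<xi>" "\<forall>\<^sub>F k in sequentially. gromov_product z (w k) y \<le> a"
  shows "point_boundary_product z y \<xi> \<le> ereal a"
proof -
  have "liminf (\<lambda>n. ereal (gromov_product z (w n) y)) \<le> limsup (\<lambda>n. ereal (gromov_product z (w n) y))"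
    by (rule Liminf_le_Limsup) simp
  also have "\<dots> \<le> ereal a"
    using assms(2) by (intro Limsup_bounded) (auto elim: eventually_mono)
  finally show ?thesis
    unfolding point_boundary_product_def using assms(1) by (intro INF_lower2) auto
qed

lemma point_boundary_product_ge:
  assumes "\<And>w. w \<in> \<xi> \<Longrightarrow> \<forall>\<^sub>F k in sequentially. a \<le> gromov_product z (w k) y"
  shows "ereal a \<le> point_boundary_product z y \<xi>"
  unfolding point_boundary_product_def
  using assms by (intro INF_greatest Liminf_bounded) (auto elim: eventually_mono)

lemma point_boundary_product_le_dist:
  assumes "\<xi> \<in> gromov_boundary p"
  shows "point_boundary_product z y \<xi> \<le> ereal (dist y z)"
proof -
  obtain w where "w \<in> \<xi>" using gromov_boundary_nonempty[OF assms] by blast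
  then show ?thesis by (rule point_boundary_product_le) (simp add: gromov_product_le_dist)
qed

lemma point_boundary_product_less_frequently:
  assumes "point_boundary_product z y \<xi> < ereal a"
  obtains w where "w \<in> \<xi>" "\<exists>\<^sub>F k in sequentially. gromov_product z (w k) y \<le> a"
proof -
  obtain w where w: "w \<in> \<xi>" "liminf (\<lambda>n. ereal (gromov_product z (w n) y)) < ereal a"
    using assms unfolding point_boundary_product_def INF_less_iff by blast
  have "\<exists>\<^sub>F k in sequentially. gromov_product z (w k) y \<le> a"
  proof (rule ccontr)
    assume "\<not> ?thesis"
    then have "\<forall>\<^sub>F k in sequentially. ereal a \<le> ereal (gromov_product z (w k) y)"
      by (auto simp: not_frequently elim: eventually_mono)
    then have "ereal a \<le> liminf (\<lambda>n. ereal (gromov_product z (w n) y))"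
      by (rule Liminf_bounded)
    with w(2) show False by simp
  qed
  with w(1) show thesis by (rule that)
qed

lemma less_point_boundary_product_eventually:
  assumes "ereal a < point_boundary_product z y \<xi>" "w \<in> \<xi>"
  shows "\<forall>\<^sub>F k in sequentially. a < gromov_product z (w k) y"
proof -
  have "ereal a < liminf (\<lambda>n. ereal (gromov_product z (w n) y))"
    using assms unfolding point_boundary_product_def by (auto dest: less_INF_D)
  from less_LiminfD[OF this] show ?thesis by simp
qed

lemma real_of_point_boundary_product_le:
  assumes "point_boundary_product z y \<xi> \<le> ereal a"
  shows "real_of_ereal (point_boundary_product z y \<xi>) \<le> a"
  using assms point_boundary_product_nonneg[of z y \<xi>]
  by (cases "point_boundary_product z y \<xi>") auto

text \<open>\<open>real_of_ereal\<close> sends infinity to 0, which would spoil a lower bound;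
  \<open>point_boundary_product_le_dist\<close> excludes that value.\<close>

lemma real_of_point_boundary_product_ge:
  assumes "ereal a \<le> point_boundary_product z y \<xi>" "\<xi> \<in> gromov_boundary p"
  shows "a \<le> real_of_ereal (point_boundary_product z y \<xi>)"
  using assms(1) point_boundary_product_le_dist[OF assms(2), of z y]
  by (cases "point_boundary_product z y \<xi>") auto

text \<open>The boundary points behind \<open>z\<close> as seen from \<open>x\<close>, up to error
  \<open>a\<close>. The condition is a weak one (one representative, infinitely many indices);
  \<open>closed_shadow_eventually\<close> upgrades it to all representatives and almost all
  indices.\<close>

definition shadow :: "'a::metric_space \<Rightarrow> 'a \<Rightarrow> 'a \<Rightarrow> real \<Rightarrow> 'a boundary_point set" where
  "shadow p z x a = {\<xi> \<in> gromov_boundary p.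
     \<exists>w\<in>\<xi>. \<exists>\<^sub>F k in sequentially. gromov_product z x (w k) \<le> a}"

lemma busemann_ge_neg_dist:
  assumes "\<xi> \<in> gromov_boundary q"
  shows "- dist p x \<le> busemann \<xi> p x"
  using real_of_point_boundary_product_le[OF point_boundary_product_le_dist[OF assms, of x p]]
    real_of_ereal_pos[OF point_boundary_product_nonneg[of p x \<xi>]]
  by (simp add: busemann_def)

locale visual_boundary =
  fixes p :: "'a::metric_space" and H b :: real
    and D :: "'a boundary_point \<Rightarrow> 'a boundary_point \<Rightarrow> real"
  assumes H_nonneg: "0 \<le> H"
    and hyperbolic:
      "\<And>x y z w :: 'a. min (gromov_product w x y) (gromov_product w y z) - H \<le> gromov_product w x z"
    and b_gt_1: "b > 1"
    and visual: "visual_metric b p D"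
begin

sublocale Metric_space "gromov_boundary p" D
  using visual by (simp add: visual_metric_def)

text \<open>Passing to the closure makes shadows Borel and costs only \<open>H\<close> in the
  error.\<close>

abbreviation closed_shadow :: "'a \<Rightarrow> 'a \<Rightarrow> real \<Rightarrow> 'a boundary_point set" where
  "closed_shadow z x a \<equiv> (closure_of) mtopology (shadow p z x a)"

text \<open>By the lower visual bound, a small distance forces a large boundary product, and this
  infimum of lower limits bounds every pair of representatives from below.\<close>

lemma visual_close:
  "\<exists>\<epsilon>>0. \<forall>\<xi>\<in>gromov_boundary p. \<forall>\<eta>\<in>gromov_boundary p. D \<xi> \<eta> < \<epsilon> \<longrightarrow>
     (\<forall>x\<in>\<xi>. \<forall>y\<in>\<eta>. \<exists>N. \<forall>n\<ge>N. \<forall>m\<ge>N. T \<le> gromov_product p (x n) (y m))"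
proof -
  obtain C where C: "C \<ge> 1" "\<And>\<xi> \<eta>. \<xi> \<in> gromov_boundary p \<Longrightarrow> \<eta> \<in> gromov_boundary p \<Longrightarrow>
      exp_neg b (boundary_product p \<xi> \<eta>) / C \<le> D \<xi> \<eta>"
    using visual unfolding visual_metric_def by blast
  define T0 where "T0 = max T 0"
  have "\<exists>N. \<forall>n\<ge>N. \<forall>m\<ge>N. T \<le> gromov_product p (x n) (y m)"
    if \<xi>: "\<xi> \<in> gromov_boundary p" and \<eta>: "\<eta> \<in> gromov_boundary p"
      and less: "D \<xi> \<eta> < b powr (- T0) / C" and x: "x \<in> \<xi>" and y: "y \<in> \<eta>" for \<xi> \<eta> x y
  proof -
    let ?B = "boundary_product p \<xi> \<eta>"
    have "exp_neg b ?B / C < b powr (- T0) / C" using C(2)[OF \<xi> \<eta>] less by linarith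
    then have *: "exp_neg b ?B < b powr (- T0)" using C(1) by (simp add: divide_less_cancel)
    have nn: "0 \<le> ?B" unfolding boundary_product_def
      by (intro INF_greatest) (auto intro!: Liminf_bounded always_eventually simp: gromov_product_nonneg)
    have "ereal T0 < ?B"
    proof (cases ?B)
      case (real r)
      then have "b powr (- r) < b powr (- T0)" using * by (simp add: exp_neg_def)
      then show ?thesis using b_gt_1 real by simp
    qed (use nn in auto)
    also have "?B \<le> Liminf (sequentially \<times>\<^sub>F sequentially) (\<lambda>(n, m). ereal (gromov_product p (x n) (y m)))"
      unfolding boundary_product_def using x y by (intro INF_lower2[of "(x, y)"]) auto
    finally have "\<forall>\<^sub>F nm in sequentially \<times>\<^sub>F sequentially.
        ereal T0 < (case nm of (n, m) \<Rightarrow> ereal (gromov_product p (x n) (y m)))"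
      by (rule less_LiminfD)
    then obtain N where "\<forall>m\<ge>N. \<forall>n\<ge>N. T0 < gromov_product p (x n) (y m)"
      by (auto simp: eventually_prod_sequentially)
    then show ?thesis unfolding T0_def by (meson less_imp_le max.cobounded1 order_trans)
  qed
  moreover have "b powr (- T0) / C > 0" using C(1) b_gt_1 by simp
  ultimately show ?thesis by (intro exI[of _ "b powr (- T0) / C"] conjI ballI impI) simp_all
qed

text \<open>A nearby shadow point has a representative \<open>v\<close> satisfying the bound
  \<open>a\<close> infinitely often. As \<open>w\<close> and \<open>v\<close> stay together far
  beyond \<open>z\<close>, the hyperbolic inequality passes the bound on to \<open>w\<close> with
  loss \<open>H\<close>.\<close>

lemma closed_shadow_eventually:
  assumes \<xi>: "\<xi> \<in> closed_shadow z x a" and w: "w \<in> \<xi>"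
  shows "\<forall>\<^sub>F k in sequentially. gromov_product z x (w k) \<le> a + H"
proof -
  \<comment> \<open>\<open>dist p z\<close> pays for moving the base point from \<open>p\<close> to
    \<open>z\<close>; the rest exceeds \<open>a + H\<close>, so that the minimum in the hyperbolic
    inequality must be the term containing \<open>x\<close>.\<close>
  let ?T = "a + H + 1 + dist p z"
  obtain \<epsilon> where \<epsilon>: "\<epsilon> > 0" "\<forall>\<xi>\<in>gromov_boundary p. \<forall>\<eta>\<in>gromov_boundary p. D \<xi> \<eta> < \<epsilon> \<longrightarrow>
      (\<forall>x\<in>\<xi>. \<forall>y\<in>\<eta>. \<exists>N. \<forall>n\<ge>N. \<forall>m\<ge>N. ?T \<le> gromov_product p (x n) (y m))"
    using visual_close[of ?T] by (elim exE conjE)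
  obtain \<zeta> where \<zeta>: "\<xi> \<in> gromov_boundary p" "\<zeta> \<in> shadow p z x a" "D \<xi> \<zeta> < \<epsilon>"
    using \<xi> \<epsilon>(1) by (auto simp: metric_closure_of)
  then obtain v where v: "v \<in> \<zeta>" "\<exists>\<^sub>F k in sequentially. gromov_product z x (v k) \<le> a"
      and \<zeta>b: "\<zeta> \<in> gromov_boundary p"
    by (auto simp: shadow_def)
  obtain N where N: "\<And>n m. n \<ge> N \<Longrightarrow> m \<ge> N \<Longrightarrow> a + H + 1 + dist p z \<le> gromov_product p (w n) (v m)"
    using \<epsilon>(2)[rule_format, OF \<zeta>(1) \<zeta>b \<zeta>(3) w v(1)] by blast
  show ?thesis
    unfolding eventually_sequentially
  proof (intro exI allI impI)
    fix n assume n: "n \<ge> N"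
    obtain m where m: "m \<ge> N" "gromov_product z x (v m) \<le> a"
      using v(2) unfolding frequently_sequentially by blast
    have "a + H + 1 \<le> gromov_product z (w n) (v m)"
      using N[OF n m(1)] gromov_product_lipschitz_base[of p "w n" "v m" z] by simp
    then show "gromov_product z x (w n) \<le> a + H"
      using hyperbolic[of z x "w n" "v m"] m(2) by linarith
  qed
qed

lemma shadow_subset_closed_shadow: "shadow p z x a \<subseteq> closed_shadow z x a"
  by (rule closure_of_subset) (auto simp: shadow_def)

lemma closed_shadow_subset_boundary: "closed_shadow z x a \<subseteq> gromov_boundary p"
  by (metis closure_of_subset_topspace topspace_mtopology)

text \<open>Behind \<open>x\<close>, the product based at \<open>x\<close> is at most
  \<open>a + H\<close>, so by \<open>gromov_product_add\<close> the one based at \<open>p\<close> is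
  at least \<open>dist p x - a - H\<close>.\<close>

lemma busemann_closed_shadow:
  assumes "\<xi> \<in> closed_shadow x p a"
  shows "dist p x - 2 * a - 2 * H \<le> busemann \<xi> p x"
proof -
  have \<xi>: "\<xi> \<in> gromov_boundary p" using assms closed_shadow_subset_boundary by blast
  have ev: "\<forall>\<^sub>F k in sequentially. gromov_product x p (w k) \<le> a + H" if "w \<in> \<xi>" for w
    using closed_shadow_eventually[OF assms that] .
  obtain w where w: "w \<in> \<xi>" using gromov_boundary_nonempty[OF \<xi>] by blast
  have "real_of_ereal (point_boundary_product x p \<xi>) \<le> a + H"
    using ev[OF w] by (intro real_of_point_boundary_product_le point_boundary_product_le[OF w])
      (simp add: gromov_product_commute)
  moreover have "dist p x - a - H \<le> real_of_ereal (point_boundary_product p x \<xi>)"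
  proof (rule real_of_point_boundary_product_ge[OF point_boundary_product_ge \<xi>])
    fix w assume "w \<in> \<xi>"
    from ev[OF this] show "\<forall>\<^sub>F k in sequentially. dist p x - a - H \<le> gromov_product p (w k) x"
    proof eventually_elim
      case (elim k)
      then show ?case using gromov_product_add[of p x "w k"] gromov_product_commute[of p x "w k"] by linarith
    qed
  qed
  ultimately show ?thesis by (simp add: busemann_def)
qed

text \<open>Up to the error, both points lie between \<open>p\<close> and \<open>y\<close>, so their
  distance is essentially their difference in height.\<close>

lemma dist_le_of_common_ray:
  assumes "gromov_product x p y \<le> a" "gromov_product x' p y \<le> a"
  shows "dist x x' \<le> \<bar>dist p x - dist p x'\<bar> + 2 * a + 2 * H"
  using assms gromov_product_add[of p x y] gromov_product_add[of p x' y] hyperbolic[of p x y x']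
    dist_conv_gromov_product[of x x' p] gromov_product_commute[of p y x']
  by linarith

end

section \<open>Isometries and Gromov sequences\<close>

lemma filterlim_at_top_diff_le:
  fixes f g :: "_ \<Rightarrow> real"
  assumes "filterlim f at_top F" "\<forall>\<^sub>F n in F. f n - c \<le> g n"
  shows "filterlim g at_top F"
  unfolding filterlim_at_top
proof
  fix T
  have "\<forall>\<^sub>F n in F. T + c \<le> f n" using assms(1) by (simp add: filterlim_at_top)
  with assms(2) show "\<forall>\<^sub>F n in F. T \<le> g n" by eventually_elim linarith
qed

text \<open>By properness and a diagonal argument, the points at each integer height
  \<open>k\<close> on the geodesics from \<open>p\<close> converge along a subsequence. If two such
  points are within 1 of each other, the endpoints have product at least
  \<open>k - 1/2\<close>.\<close>

lemma gromov_subsequence: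
  fixes x :: "nat \<Rightarrow> 'a::metric_space"
  assumes "proper_metric TYPE('a)" "geodesic_metric TYPE('a)" and x: "\<And>n. real n \<le> dist p (x n)"
  obtains r where "strict_mono (r :: nat \<Rightarrow> nat)" "x \<circ> r \<in> gromov_sequences p"
proof -
  have "\<exists>\<gamma>. geodesic_segment \<gamma> p (x i)" for i
    using assms(2) by (simp add: geodesic_metric_def)
  then obtain \<gamma> where \<gamma>: "\<And>i. geodesic_segment (\<gamma> i) p (x i)" by metis
  define c where "c k i = \<gamma> i (min (real k) (dist p (x i)))" for k i
  have c_dist: "dist p (c k i) = min (real k) (dist p (x i))"
      "dist (c k i) (x i) = dist p (x i) - min (real k) (dist p (x i))" for k i
  proof -
    let ?m = "min (real k) (dist p (x i))"
    have \<gamma>i: "\<gamma> i 0 = p" "\<gamma> i (dist p (x i)) = x i"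
      "\<And>s t. s \<in> {0..dist p (x i)} \<Longrightarrow> t \<in> {0..dist p (x i)} \<Longrightarrow> dist (\<gamma> i s) (\<gamma> i t) = \<bar>s - t\<bar>"
      using \<gamma>[of i] by (auto simp: geodesic_segment_def)
    show "dist p (c k i) = ?m" using \<gamma>i(3)[of 0 ?m] \<gamma>i(1) by (simp add: c_def)
    show "dist (c k i) (x i) = dist p (x i) - ?m"
      using \<gamma>i(3)[of ?m "dist p (x i)"] \<gamma>i(2) by (simp add: c_def)
  qed
  interpret subseqs "\<lambda>k s. convergent (\<lambda>i. c k (s i))"
  proof
    fix k and s :: "nat \<Rightarrow> nat"
    have "compact (cball p (real k))" using assms(1) by (simp add: proper_metric_def)
    moreover have "\<forall>i. c k (s i) \<in> cball p (real k)" by (simp add: c_dist)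
    ultimately obtain l r where "strict_mono r" "((\<lambda>i. c k (s i)) \<circ> r) \<longlonglongrightarrow> l"
      unfolding compact_def by meson
    then show "\<exists>r'. strict_mono r' \<and> convergent (\<lambda>i. c k ((s \<circ> r') i))"
      by (auto simp: convergent_def o_def)
  qed
  have conv: "convergent (\<lambda>i. c k (diagseq i))" for k
  proof -
    \<comment> \<open>From index \<open>Suc k\<close> on, the diagonal sequence is a subsequence of
      one along which \<open>c k\<close> converges.\<close>
    have "convergent (\<lambda>i. c k ((diagseq \<circ> ((+) (Suc k))) i))"
    proof (rule diagseq_holds)
      fix r s :: "nat \<Rightarrow> nat" and n
      assume "strict_mono r" "convergent (\<lambda>i. c n (s i))"
      then show "convergent (\<lambda>i. c n ((s \<circ> r) i))"
        using convergent_subseq_convergent[of "\<lambda>i. c n (s i)" r] by (simp add: o_def)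
    qed
    then show ?thesis
      using convergent_ignore_initial_segment[of "\<lambda>i. c k (diagseq i)" "Suc k"]
      by (simp add: add.commute)
  qed
  have "x \<circ> diagseq \<in> gromov_sequences p"
    unfolding gromov_sequences_iff
  proof
    fix T :: real
    define k where "k = nat \<lceil>T + 1\<rceil>"
    have k: "T + 1 \<le> real k" unfolding k_def by linarith
    have "Cauchy (\<lambda>i. c k (diagseq i))" using conv by (rule convergent_Cauchy)
    then obtain N where N: "\<And>m n. m \<ge> N \<Longrightarrow> n \<ge> N \<Longrightarrow> dist (c k (diagseq m)) (c k (diagseq n)) < 1"
      by (metis Cauchy_def zero_less_one)
    have "T \<le> gromov_product p (x (diagseq m)) (x (diagseq n))" if "m \<ge> max N k" "n \<ge> max N k" for m n
    proof -
      have far: "real k \<le> dist p (x (diagseq i))" if "i \<ge> k" for i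
        using x[of "diagseq i"] seq_suble[OF subseq_diagseq, of i] that by linarith
      let ?m = "diagseq m" and ?n = "diagseq n"
      have "dist (c k ?m) (x ?m) = dist p (x ?m) - k" "dist (c k ?n) (x ?n) = dist p (x ?n) - k"
        using far[of m] far[of n] that by (auto simp: c_dist)
      moreover have "dist (x ?m) (x ?n) \<le> dist (c k ?m) (x ?m) + dist (c k ?m) (c k ?n) + dist (c k ?n) (x ?n)"
        using dist_triangle[of "x ?m" "x ?n" "c k ?m"] dist_triangle[of "c k ?m" "x ?n" "c k ?n"]
        by (simp add: dist_commute)
      moreover have "dist (c k ?m) (c k ?n) < 1" using N that by simp
      ultimately show ?thesis
        using k dist_conv_gromov_product[of "x ?m" "x ?n" p] by linarith
    qed
    then show "\<exists>N. \<forall>n\<ge>N. \<forall>m\<ge>N. T \<le> gromov_product p ((x \<circ> diagseq) m) ((x \<circ> diagseq) n)"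
      by (intro exI[of _ "max N k"]) simp
  qed
  with subseq_diagseq show thesis by (rule that)
qed

locale visual_group = visual_boundary +
  fixes G :: "('a \<Rightarrow> 'a) set"
  assumes subgroup_G: "subgroup G isometry_group"
begin

abbreviation iv :: "('a \<Rightarrow> 'a) \<Rightarrow> 'a \<Rightarrow> 'a" where
  "iv g \<equiv> inv\<^bsub>isometry_group\<^esub> g"

lemma G_carrier: "g \<in> G \<Longrightarrow> g \<in> carrier isometry_group"
  using subgroup.mem_carrier[OF subgroup_G] .

lemma G_dist: "g \<in> G \<Longrightarrow> dist (g x) (g y) = dist x y"
  using G_carrier by (auto simp: isometry_group_def)

lemma G_id: "id \<in> G"
  using subgroup.one_closed[OF subgroup_G] by (simp add: isometry_group_def)

lemma G_comp: "g \<in> G \<Longrightarrow> h \<in> G \<Longrightarrow> g \<circ> h \<in> G"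
  using subgroup.m_closed[OF subgroup_G, of g h] by (simp add: isometry_group_def)

lemma G_inv: "g \<in> G \<Longrightarrow> iv g \<in> G"
  using subgroup.m_inv_closed[OF subgroup_G] .

lemma iv_apply: "g \<in> G \<Longrightarrow> iv g (g x) = x"
  using fun_cong[OF group.l_inv[OF group_isometry_group G_carrier[of g]], of x]
  by (simp add: isometry_group_def)

lemma apply_iv: "g \<in> G \<Longrightarrow> g (iv g x) = x"
  using fun_cong[OF group.r_inv[OF group_isometry_group G_carrier[of g]], of x]
  by (simp add: isometry_group_def)

lemma iv_iv: "g \<in> G \<Longrightarrow> iv (iv g) = g"
  using group.inv_inv[OF group_isometry_group G_carrier] .

lemma dist_iv: "g \<in> G \<Longrightarrow> dist x (iv g y) = dist (g x) y"
  using G_dist[of g x "iv g y"] by (simp add: apply_iv)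

lemma G_gromov_product: "g \<in> G \<Longrightarrow> gromov_product (g z) (g x) (g y) = gromov_product z x y"
  by (rule gromov_product_isometry) (rule G_dist)

lemma gromov_product_shift:
  "g \<in> G \<Longrightarrow> gromov_product p x y - dist p (g p) \<le> gromov_product p (g x) (g y)"
  using gromov_product_lipschitz_base[of "g p" "g x" "g y" p] G_gromov_product[of g p x y]
  by (simp add: dist_commute)

text \<open>That \<open>y\<close> is a Gromov sequence follows along the chain \<open>y m\<close>,
  \<open>x m\<close>, \<open>x n\<close>, \<open>y n\<close>: consecutive products are large, and
  each intermediate point costs \<open>H\<close>.\<close>

lemma gromov_equivI:
  assumes x: "x \<in> gromov_sequences p"
    and xy: "filterlim (\<lambda>n. gromov_product p (x n) (y n)) at_top sequentially"
  shows "(x, y) \<in> gromov_equiv p"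
proof -
  have "y \<in> gromov_sequences p"
    unfolding gromov_sequences_iff
  proof
    fix T :: real
    obtain N where N: "\<And>m n. m \<ge> N \<Longrightarrow> n \<ge> N \<Longrightarrow> T + 2 * H \<le> gromov_product p (x m) (x n)"
      using x unfolding gromov_sequences_iff by meson
    obtain M where M: "\<And>n. n \<ge> M \<Longrightarrow> T + 2 * H \<le> gromov_product p (x n) (y n)"
      using xy unfolding filterlim_at_top eventually_sequentially by meson
    show "\<exists>N. \<forall>n\<ge>N. \<forall>m\<ge>N. T \<le> gromov_product p (y m) (y n)"
    proof (intro exI[of _ "max N M"] allI impI)
      fix n m assume mn: "m \<ge> max N M" "n \<ge> max N M"
      have "T + H \<le> gromov_product p (x m) (y n)"
        using N[of m n] M[of n] mn hyperbolic[of p "x m" "x n" "y n"] by simp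
      then show "T \<le> gromov_product p (y m) (y n)"
        using M[of m] mn H_nonneg hyperbolic[of p "y m" "x m" "y n"] gromov_product_commute[of p "x m" "y m"]
        by simp
    qed
  qed
  with assms show ?thesis by (simp add: gromov_equiv_def)
qed

lemma gromov_equiv_sym: "(x, y) \<in> gromov_equiv p \<Longrightarrow> (y, x) \<in> gromov_equiv p"
  by (simp add: gromov_equiv_def gromov_product_commute)

lemma gromov_equiv_trans:
  assumes "(x, y) \<in> gromov_equiv p" "(y, z) \<in> gromov_equiv p"
  shows "(x, z) \<in> gromov_equiv p"
proof -
  have "filterlim (\<lambda>n. gromov_product p (x n) (z n)) at_top sequentially"
    unfolding filterlim_at_top
  proof
    fix T
    have "\<forall>\<^sub>F n in sequentially. T + H \<le> gromov_product p (x n) (y n)"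
      "\<forall>\<^sub>F n in sequentially. T + H \<le> gromov_product p (y n) (z n)"
      using assms by (auto simp: gromov_equiv_def filterlim_at_top)
    then show "\<forall>\<^sub>F n in sequentially. T \<le> gromov_product p (x n) (z n)"
    proof eventually_elim
      case (elim n)
      then show ?case using hyperbolic[of p "x n" "y n" "z n"] by linarith
    qed
  qed
  with assms show ?thesis by (simp add: gromov_equiv_def)
qed

lemma gromov_equiv_isometry:
  assumes g: "g \<in> G" and xy: "(x, y) \<in> gromov_equiv p"
  shows "(g \<circ> x, g \<circ> y) \<in> gromov_equiv p"
proof (rule gromov_equivI)
  have "filterlim (\<lambda>(n, m). gromov_product p (x n) (x m)) at_top (sequentially \<times>\<^sub>F sequentially)"
    using xy by (simp add: gromov_equiv_def gromov_sequences_def)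
  then have "filterlim (\<lambda>(n, m). gromov_product p (g (x n)) (g (x m))) at_top (sequentially \<times>\<^sub>F sequentially)"
    by (rule filterlim_at_top_diff_le[where c = "dist p (g p)", OF _ always_eventually])
      (use gromov_product_shift[OF g] in auto)
  then show "g \<circ> x \<in> gromov_sequences p" by (simp add: gromov_sequences_def)
  have "filterlim (\<lambda>n. gromov_product p (x n) (y n)) at_top sequentially"
    using xy by (simp add: gromov_equiv_def)
  then show "filterlim (\<lambda>n. gromov_product p ((g \<circ> x) n) ((g \<circ> y) n)) at_top sequentially"
    by (rule filterlim_at_top_diff_le[where c = "dist p (g p)", OF _ always_eventually])
      (use gromov_product_shift[OF g] in auto)
qed

text \<open>The action maps a class elementwise, so being fixed is an equality of sets; for the
  reverse inclusion, elements are pulled back by \<open>iv g\<close>.\<close>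

lemma boundary_fixed_pointI:
  assumes g: "g \<in> G" and xgx: "(x, g \<circ> x) \<in> gromov_equiv p"
  shows "gromov_equiv p `` {x} \<in> boundary_fixed_points p g"
proof -
  have iv_comp: "iv g \<circ> (g \<circ> y) = y" "g \<circ> (iv g \<circ> y) = y" for y :: "nat \<Rightarrow> 'a"
    by (simp_all add: fun_eq_iff iv_apply[OF g] apply_iv[OF g])
  have "boundary_action g (gromov_equiv p `` {x}) = gromov_equiv p `` {x}"
  proof (intro equalityI subsetI)
    fix y assume "y \<in> boundary_action g (gromov_equiv p `` {x})"
    then obtain y' where "y = g \<circ> y'" "(x, y') \<in> gromov_equiv p" by (auto simp: boundary_action_def)
    then show "y \<in> gromov_equiv p `` {x}"
      using gromov_equiv_trans[OF xgx] gromov_equiv_isometry[OF g] by blast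
  next
    fix y assume "y \<in> gromov_equiv p `` {x}"
    then have y: "(x, y) \<in> gromov_equiv p" by simp
    have "(iv g \<circ> x, x) \<in> gromov_equiv p"
      using gromov_equiv_isometry[OF G_inv[OF g] xgx] by (simp add: iv_comp)
    then have "(x, iv g \<circ> y) \<in> gromov_equiv p"
      using gromov_equiv_trans[OF gromov_equiv_sym] gromov_equiv_isometry[OF G_inv[OF g] y] by blast
    then show "y \<in> boundary_action g (gromov_equiv p `` {x})"
      unfolding boundary_action_def by (intro image_eqI[of _ _ "iv g \<circ> y"]) (simp_all add: iv_comp)
  qed
  moreover have "gromov_equiv p `` {x} \<in> gromov_boundary p"
    unfolding gromov_boundary_def by (rule quotientI) (use xgx in \<open>simp add: gromov_equiv_def\<close>)
  ultimately show ?thesis by (simp add: boundary_fixed_points_def)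
qed

text \<open>If the Gromov products \<open>\<langle>x|f y\<rangle>\<close> could all be arbitrarily large, then \<open>x\<close>, \<open>y\<close>, \<open>f\<^sub>1 y\<close> and
  \<open>f\<^sub>2 y\<close> would subconverge to the same boundary point, which both \<open>f\<^sub>1\<close> and \<open>f\<^sub>2\<close> would fix.\<close>

lemma uniformly_transverse:
  assumes "proper_metric TYPE('a)" "geodesic_metric TYPE('a)"
    and f: "f1 \<in> G" "f2 \<in> G" "boundary_fixed_points p f1 \<inter> boundary_fixed_points p f2 = {}"
  shows "\<exists>C\<ge>0. \<forall>x y. \<exists>f\<in>{id, f1, f2}. gromov_product p x (f y) \<le> C"
proof (rule ccontr)
  assume "\<not> ?thesis"
  then have "\<exists>x y. \<forall>f\<in>{id, f1, f2}. real n < gromov_product p x (f y)" for n :: nat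
    using of_nat_0_le_iff[of n] by (metis not_less)
  then obtain x y where xy: "\<And>n f. f \<in> {id, f1, f2} \<Longrightarrow> real n < gromov_product p (x n) (f (y n))"
    by metis
  \<comment> \<open>The case \<open>f = id\<close> makes \<open>x n\<close> leave every ball, as
    needed to extract a Gromov subsequence.\<close>
  have "real n \<le> dist p (x n)" for n
    using xy[of id n] gromov_product_le_dist(1)[of p "x n" "id (y n)"] by (simp add: dist_commute)
  then obtain r where r: "strict_mono r" "x \<circ> r \<in> gromov_sequences p"
    using gromov_subsequence[OF assms(1,2)] by blast
  have *: "(x \<circ> r, f \<circ> (y \<circ> r)) \<in> gromov_equiv p" if "f \<in> {id, f1, f2}" for f
  proof (rule gromov_equivI[OF r(2)])
    show "filterlim (\<lambda>n. gromov_product p ((x \<circ> r) n) ((f \<circ> (y \<circ> r)) n)) at_top sequentially"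
    proof (rule filterlim_at_top_mono[OF filterlim_real_sequentially always_eventually, rule_format])
      fix n
      show "real n \<le> gromov_product p ((x \<circ> r) n) ((f \<circ> (y \<circ> r)) n)"
        using xy[OF that, of "r n"] seq_suble[OF r(1), of n] by simp
    qed
  qed
  have "gromov_equiv p `` {x \<circ> r} \<in> boundary_fixed_points p f" if fF: "f \<in> {f1, f2}" for f
  proof (rule boundary_fixed_pointI)
    show fG: "f \<in> G" using fF f by auto
    \<comment> \<open>The case \<open>id\<close> makes \<open>x\<close> and \<open>y\<close>
      equivalent, hence also \<open>f x\<close> and \<open>f y\<close>; as \<open>x\<close> is
      equivalent to \<open>f y\<close>, it is equivalent to \<open>f x\<close>.\<close>
    have "(f \<circ> (x \<circ> r), f \<circ> (y \<circ> r)) \<in> gromov_equiv p"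
      using gromov_equiv_isometry[OF fG] *[of id] by simp
    then show "(x \<circ> r, f \<circ> (x \<circ> r)) \<in> gromov_equiv p"
      using gromov_equiv_trans gromov_equiv_sym *[of f] fF by blast
  qed
  with f(3) show False by blast
qed

section \<open>The uniformly radial limit set\<close>

definition level :: "nat \<Rightarrow> nat \<Rightarrow> ('a \<Rightarrow> 'a) set" where
  "level N n = {g \<in> G. real n \<le> dist p (g p) \<and> dist p (g p) \<le> real n + real N}"

text \<open>Uniform radiality with a fixed constant, indexed by heights instead of sequences: for
  finite levels this is a countable intersection of finite unions of closed sets, hence
  Borel.\<close>

definition radial_set :: "nat \<Rightarrow> 'a boundary_point set" where
  "radial_set N = (\<Inter>n. \<Union>g\<in>level N n. closed_shadow (g p) p (real N))"

lemma radial_set_subset_uniformly_radial: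
  "radial_set N \<subseteq> uniformly_radial_limit_set p G"
proof
  fix \<eta> assume "\<eta> \<in> radial_set N"
  then have "\<exists>g. g \<in> level N n \<and> \<eta> \<in> closed_shadow (g p) p N" for n
    by (auto simp: radial_set_def)
  then obtain g where g: "\<And>n. g n \<in> level N n" "\<And>n. \<eta> \<in> closed_shadow (g n p) p N" by metis
  \<comment> \<open>\<open>id\<close> is put in front because the sequence has to start at
    \<open>p\<close>.\<close>
  define h where "h = case_nat id g"
  \<comment> \<open>Heights in consecutive levels differ by at most \<open>N + 1\<close>;
    \<open>dist_le_of_common_ray\<close> with error \<open>N + H\<close> adds
    \<open>2 * (N + H) + 2 * H\<close>.\<close>
  define \<sigma> where "\<sigma> = 3 * real N + 4 * H + 1"
  have \<eta>: "\<eta> \<in> gromov_boundary p" using g(2) closed_shadow_subset_boundary by blast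
  obtain w where w: "w \<in> \<eta>" using gromov_boundary_nonempty[OF \<eta>] by blast
  have ev: "\<forall>\<^sub>F k in sequentially. gromov_product (g n p) p (v k) \<le> N + H" if "v \<in> \<eta>" for n v
    using closed_shadow_eventually[OF g(2) that] .
  have "\<sigma> > 0" using H_nonneg by (simp add: \<sigma>_def)
  moreover have "h n \<in> G" for n
    using g(1) G_id by (auto simp: h_def level_def split: nat.splits)
  moreover have "h 0 p = p" by (simp add: h_def)
  moreover have "converges_to_boundary p (\<lambda>n. h n p) \<eta>"
  proof -
    have "ereal (real n - real N - H) \<le> point_boundary_product p (g n p) \<eta>" for n
    proof (rule point_boundary_product_ge)
      fix v assume "v \<in> \<eta>"
      from ev[OF this, of n]
      show "\<forall>\<^sub>F k in sequentially. real n - real N - H \<le> gromov_product p (v k) (g n p)"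
      proof eventually_elim
        case (elim k)
        then show ?case using g(1)[of n] gromov_product_add[of p "g n p" "v k"]
          by (simp add: level_def gromov_product_commute)
      qed
    qed
    note ge = this
    have "(\<lambda>n. point_boundary_product p (g n p) \<eta>) \<longlonglongrightarrow> \<infinity>"
      unfolding tendsto_PInfty
    proof
      fix r :: real
      have "\<forall>\<^sub>F n in sequentially. r + real N + H < real n"
        using filterlim_real_sequentially unfolding filterlim_at_top_dense by blast
      then show "\<forall>\<^sub>F n in sequentially. ereal r < point_boundary_product p (g n p) \<eta>"
      proof eventually_elim
        case (elim n)
        then have "ereal r < ereal (real n - real N - H)" by simp
        also note ge
        finally show ?case .
      qed
    qed
    then have "(\<lambda>n. point_boundary_product p (h (Suc n) p) \<eta>) \<longlonglongrightarrow> \<infinity>" by (simp add: h_def)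
    then show ?thesis
      unfolding converges_to_boundary_def by (rule LIMSEQ_imp_Suc)
  qed
  moreover have "point_boundary_product (h n p) p \<eta> \<le> ereal \<sigma>" for n
  proof (rule point_boundary_product_le[OF w], cases n)
    case 0
    then show "\<forall>\<^sub>F k in sequentially. gromov_product (h n p) (w k) p \<le> \<sigma>"
      using \<open>\<sigma> > 0\<close> by (intro always_eventually) (simp add: h_def gromov_product_def dist_commute)
  next
    case (Suc m)
    from ev[OF w, of m] show "\<forall>\<^sub>F k in sequentially. gromov_product (h n p) (w k) p \<le> \<sigma>"
    proof eventually_elim
      case (elim k)
      then show ?case using Suc H_nonneg by (simp add: h_def \<sigma>_def gromov_product_commute)
    qed
  qed
  moreover have "dist (h n p) (h (Suc n) p) \<le> \<sigma>" for n
  proof (cases n)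
    case 0
    then show ?thesis using g(1)[of 0] H_nonneg by (simp add: h_def level_def \<sigma>_def)
  next
    case (Suc m)
    have "\<forall>\<^sub>F k in sequentially. gromov_product (g m p) p (w k) \<le> N + H \<and> gromov_product (g (Suc m) p) p (w k) \<le> N + H"
      using ev[OF w] by (intro eventually_conj)
    then obtain k where "gromov_product (g m p) p (w k) \<le> N + H" "gromov_product (g (Suc m) p) p (w k) \<le> N + H"
      unfolding eventually_sequentially by blast
    from dist_le_of_common_ray[OF this] show ?thesis
      using g(1)[of m] g(1)[of "Suc m"] unfolding level_def h_def Suc \<sigma>_def by (simp add: abs_if split: if_splits)
  qed
  ultimately show "\<eta> \<in> uniformly_radial_limit_set p G"
    using \<eta> unfolding uniformly_radial_limit_set_def by blast
qed

text \<open>A sequence with steps of length at most \<open>\<sigma> < N\<close> cannot jump over a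
  height window of width \<open>N\<close>.\<close>

lemma uniformly_radial_eq: "uniformly_radial_limit_set p G = (\<Union>N. radial_set N)"
proof
  show "uniformly_radial_limit_set p G \<subseteq> (\<Union>N. radial_set N)"
  proof
    fix \<eta> assume "\<eta> \<in> uniformly_radial_limit_set p G"
    then obtain \<sigma> g where \<eta>: "\<eta> \<in> gromov_boundary p" and \<sigma>: "\<sigma> > 0"
      and g: "\<And>n. g n \<in> G" "g 0 p = p" "converges_to_boundary p (\<lambda>n. g n p) \<eta>"
        "\<And>n. point_boundary_product (g n p) p \<eta> \<le> ereal \<sigma>" "\<And>n. dist (g n p) (g (Suc n) p) \<le> \<sigma>"
      unfolding uniformly_radial_limit_set_def by blast
    obtain N :: nat where N: "\<sigma> < N" using reals_Archimedean2 by blast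
    have "\<exists>h\<in>level N n. \<eta> \<in> closed_shadow (h p) p N" for n
    proof -
      have "\<forall>\<^sub>F i in sequentially. ereal n < point_boundary_product p (g i p) \<eta>"
        using g(3) by (auto simp: converges_to_boundary_def tendsto_PInfty)
      then obtain i where "ereal n < point_boundary_product p (g i p) \<eta>"
        unfolding eventually_sequentially by blast
      also have "\<dots> \<le> ereal (dist (g i p) p)" by (rule point_boundary_product_le_dist[OF \<eta>])
      finally have ex: "real n \<le> dist p (g i p)" by (simp add: dist_commute)
      \<comment> \<open>At the first time height \<open>n\<close> is reached, the overshoot is at
        most one step.\<close>
      define j where "j = (LEAST i. real n \<le> dist p (g i p))"
      have j: "real n \<le> dist p (g j p)" unfolding j_def using ex by (rule LeastI)
      have "dist p (g j p) \<le> real n + \<sigma>"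
      proof (cases j)
        case 0
        then show ?thesis using g(2) \<sigma> by simp
      next
        case (Suc i)
        then have "\<not> real n \<le> dist p (g i p)" unfolding j_def by (metis lessI not_less_Least)
        then show ?thesis
          using Suc g(5)[of i] dist_triangle[of p "g j p" "g i p"] by simp
      qed
      then have "g j \<in> level N n" using j g(1) N by (simp add: level_def)
      moreover have "point_boundary_product (g j p) p \<eta> < ereal N" using g(4)[of j] N
        by (meson ereal_less_eq(3) le_less_trans less_ereal.simps(1))
      then obtain w where "w \<in> \<eta>" "\<exists>\<^sub>F k in sequentially. gromov_product (g j p) (w k) p \<le> N"
        by (rule point_boundary_product_less_frequently)
      then have "\<eta> \<in> shadow p (g j p) p N"
        using \<eta> by (auto simp: shadow_def gromov_product_commute)
      then have "\<eta> \<in> closed_shadow (g j p) p N" using shadow_subset_closed_shadow by blast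
      ultimately show ?thesis by blast
    qed
    then show "\<eta> \<in> (\<Union>N. radial_set N)" unfolding radial_set_def by blast
  qed
qed (use radial_set_subset_uniformly_radial in blast)

text \<open>A geodesic from \<open>p\<close> to a late orbit point heads towards
  \<open>\<eta>\<close> up to any given height, and quasiconvexity puts an orbit point near it
  there.\<close>

lemma limit_set_subset_uniformly_radial:
  assumes geo: "geodesic_metric TYPE('a)" and qc: "quasiconvex_cocompact p G"
  shows "limit_set p G \<subseteq> uniformly_radial_limit_set p G"
proof
  fix \<eta> assume "\<eta> \<in> limit_set p G"
  then obtain g where \<eta>: "\<eta> \<in> gromov_boundary p" and g: "\<And>n::nat. g n \<in> G"
      "converges_to_boundary p (\<lambda>n. g n p) \<eta>"
    unfolding limit_set_def by blast
  obtain \<rho> where \<rho>: "\<rho> > 0" and qc': "\<forall>x\<in>(\<lambda>g. g p) ` G. \<forall>y\<in>(\<lambda>g. g p) ` G. \<forall>\<gamma>.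
      geodesic_segment \<gamma> x y \<longrightarrow> \<gamma> ` {0..dist x y} \<subseteq> (\<Union>z\<in>(\<lambda>g. g p) ` G. ball z \<rho>)"
    using qc unfolding quasiconvex_cocompact_def by (elim exE conjE)
  obtain N :: nat where N: "2 * \<rho> + H < N" using reals_Archimedean2 by blast
  obtain w where w: "w \<in> \<eta>" using gromov_boundary_nonempty[OF \<eta>] by blast
  have "\<exists>h\<in>level N n. \<eta> \<in> closed_shadow (h p) p N" for n
  proof -
    \<comment> \<open>An orbit point within \<open>\<rho>\<close> of this height has height between
      \<open>n\<close> and \<open>n + 2 * \<rho>\<close>, which fits the window of width
      \<open>N\<close>.\<close>
    let ?t = "real n + \<rho>"
    have "\<forall>\<^sub>F i in sequentially. ereal ?t < point_boundary_product p (g i p) \<eta>"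
      using g(2) by (auto simp: converges_to_boundary_def tendsto_PInfty)
    then obtain i where i: "ereal ?t < point_boundary_product p (g i p) \<eta>"
      unfolding eventually_sequentially by blast
    also have "\<dots> \<le> ereal (dist (g i p) p)" by (rule point_boundary_product_le_dist[OF \<eta>])
    finally have t: "?t \<in> {0..dist p (g i p)}" using \<rho> by (simp add: dist_commute)
    obtain \<gamma> where \<gamma>: "geodesic_segment \<gamma> p (g i p)" using geo by (auto simp: geodesic_metric_def)
    define x where "x = \<gamma> ?t"
    have x: "dist p x = ?t" "dist x (g i p) = dist p (g i p) - ?t"
    proof -
      have *: "\<And>s t. s \<in> {0..dist p (g i p)} \<Longrightarrow> t \<in> {0..dist p (g i p)} \<Longrightarrow> dist (\<gamma> s) (\<gamma> t) = \<bar>s - t\<bar>"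
        "\<gamma> 0 = p" "\<gamma> (dist p (g i p)) = g i p"
        using \<gamma> by (auto simp: geodesic_segment_def)
      show "dist p x = ?t" using *(1)[of 0 ?t] *(2) t by (simp add: x_def)
      show "dist x (g i p) = dist p (g i p) - ?t"
        using *(1)[of ?t "dist p (g i p)"] *(3) t by (simp add: x_def)
    qed
    have p_orbit: "p \<in> (\<lambda>g. g p) ` G" using G_id by (rule rev_image_eqI) simp
    then have "x \<in> (\<Union>z\<in>(\<lambda>g. g p) ` G. ball z \<rho>)"
      using qc'[rule_format, OF p_orbit imageI[OF g(1)] \<gamma>] t unfolding x_def by blast
    then obtain h where h: "h \<in> G" "dist (h p) x < \<rho>" by auto
    have "h \<in> level N n"
      using h x(1) N H_nonneg \<rho> dist_triangle[of p x "h p"] dist_triangle[of p "h p" x]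
      by (simp add: level_def dist_commute)
    moreover have "\<forall>\<^sub>F k in sequentially. gromov_product (h p) p (w k) \<le> N"
      using less_point_boundary_product_eventually[OF i w]
    proof eventually_elim
      case (elim k)
      have "gromov_product p x (g i p) = ?t" using x by (simp add: gromov_product_def dist_commute)
      then have "?t - H \<le> gromov_product p x (w k)"
        using elim hyperbolic[of p x "g i p" "w k"] gromov_product_commute[of p "w k" "g i p"] by simp
      then have "gromov_product x p (w k) \<le> H" using gromov_product_add[of p x "w k"] x(1) by simp
      then show ?case using gromov_product_lipschitz_base[of "h p" p "w k" x] h(2) N \<rho> by simp
    qed
    then have "\<eta> \<in> shadow p (h p) p N"
      using \<eta> w eventually_frequently[OF sequentially_bot] by (auto simp: shadow_def)
    then have "\<eta> \<in> closed_shadow (h p) p N" using shadow_subset_closed_shadow by blast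
    ultimately show ?thesis by blast
  qed
  then have "\<eta> \<in> radial_set N" unfolding radial_set_def by blast
  then show "\<eta> \<in> uniformly_radial_limit_set p G" using radial_set_subset_uniformly_radial by blast
qed

end

section \<open>Detours away from the orbit\<close>

context visual_boundary
begin

text \<open>Here \<open>z\<close> is a point of a geodesic from \<open>o'\<close> to \<open>e\<close> that is far from both ends; paths from
  \<open>a\<close> via \<open>o\<close> and \<open>e\<close> to \<open>y\<close> without backtracking must pass near \<open>z\<close>.\<close>

lemma passes_near_detour:
  fixes q q' a e y z :: 'a
  assumes "dist q q' \<le> L" "gromov_product z q' e \<le> 0" "gromov_product q a e \<le> A"
    "gromov_product e q y \<le> B" "R \<le> dist z q" "R \<le> dist z e" "L + A + B + 3 * H < R"
    "0 \<le> A" "0 \<le> B"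
  shows "gromov_product z a y \<le> L + 2 * H"
proof -
  have qe: "gromov_product z q e \<le> L"
    using gromov_product_lipschitz[of z q e q'] assms(1,2) by simp
  \<comment> \<open>Seen from \<open>q\<close>, the points \<open>z\<close> and \<open>e\<close>
    agree up to \<open>R - L\<close>; since \<open>a\<close> separates from \<open>e\<close> early,
    it separates from \<open>z\<close> early too.\<close>
  have "R - L \<le> gromov_product q z e"
    using gromov_product_add[of q z e] qe assms(5) by (simp add: dist_commute)
  then have "gromov_product q a z \<le> A + H"
    using hyperbolic[of q a z e] assms(3,7,8,9) H_nonneg by linarith
  then have "L + H < gromov_product z q a"
    using gromov_product_add[of q z a] gromov_product_commute[of q a z] assms(5,7,9) H_nonneg
    by (simp add: dist_commute)
  then have ae: "gromov_product z a e \<le> L + H"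
    using hyperbolic[of z q a e] qe by linarith
  \<comment> \<open>The same argument at the other end \<open>e\<close>, with \<open>y\<close> in
    place of \<open>a\<close>.\<close>
  have "R - L \<le> gromov_product e z q"
    using gromov_product_add[of e z q] gromov_product_commute[of z q e] qe assms(6)
    by (simp add: dist_commute)
  then have "gromov_product e z y \<le> B + H"
    using hyperbolic[of e q z y] gromov_product_commute[of e q z] assms(4,7,8,9) H_nonneg by linarith
  then have "L + 2 * H < gromov_product z y e"
    using gromov_product_add[of e z y] gromov_product_commute[of z e y] assms(6,7,8) H_nonneg
    by (simp add: dist_commute)
  then show ?thesis
    using hyperbolic[of z a y e] ae by linarith
qed

text \<open>The orbit point \<open>u\<close> and the point \<open>z\<close> are at the same height, and so far below \<open>g\<close> and \<open>g'\<close>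
  that the rays to \<open>w\<close> and \<open>y\<close> have not separated yet.\<close>

lemma close_to_orbit_below_branching:
  fixes z g u w y :: 'a
  assumes "gromov_product z p y \<le> a" "gromov_product g p y \<le> c"
    "gromov_product g p w \<le> d" "gromov_product u p w \<le> d"
    "dist p z - 1 \<le> dist p u" "dist p u \<le> dist p z + n"
    "dist p z + c + d \<le> dist p g" "0 \<le> a" "0 \<le> c" "0 \<le> d"
  shows "dist z u \<le> n + 2 + 2 * a + 2 * d + 4 * H"
proof -
  \<comment> \<open>\<open>z\<close> and \<open>g\<close> are compared via \<open>y\<close>, then
    \<open>g\<close> and \<open>u\<close> via \<open>w\<close>; chaining through \<open>g\<close>
    compares \<open>z\<close> with \<open>u\<close>.\<close>
  have "dist p z - a - H \<le> gromov_product p z g"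
    using gromov_product_add[of p z y] gromov_product_add[of p g y] hyperbolic[of p z y g]
      gromov_product_commute[of p y g] assms by linarith
  moreover have "dist p z - 1 - d - H \<le> gromov_product p g u"
    using gromov_product_add[of p g w] gromov_product_add[of p u w] hyperbolic[of p g w u]
      gromov_product_commute[of p w u] assms by linarith
  ultimately have "dist p z - 1 - a - d - 2 * H \<le> gromov_product p z u"
    using hyperbolic[of p z g u] assms H_nonneg by linarith
  then show ?thesis
    using dist_conv_gromov_product[of z u p] assms by linarith
qed

end

text \<open>The sum of the indicators counts the sets containing a point; integrating this count
  gives the bound.\<close>

lemma (in finite_measure) sum_measure_le_multiplicity:
  assumes "finite I" "\<And>i. i \<in> I \<Longrightarrow> B i \<in> sets M"
    and mult: "\<And>x. card {i \<in> I. x \<in> B i} \<le> m"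
  shows "(\<Sum>i\<in>I. measure M (B i)) \<le> real m * measure M (space M)"
proof -
  have "(\<Sum>i\<in>I. measure M (B i)) = (\<Sum>i\<in>I. \<integral>x. indicator (B i) x \<partial>M)"
    using assms(2) by simp
  also have "\<dots> = (\<integral>x. (\<Sum>i\<in>I. indicator (B i) x) \<partial>M)"
    using assms(2) by (intro Bochner_Integration.integral_sum[symmetric]) (simp add: less_top[symmetric])
  also have "\<dots> \<le> (\<integral>x. real m \<partial>M)"
  proof (rule integral_mono)
    show "integrable M (\<lambda>x. \<Sum>i\<in>I. indicator (B i) x :: real)"
      using assms(2) by (intro Bochner_Integration.integrable_sum) (simp add: less_top[symmetric])
    fix x
    have "(\<Sum>i\<in>I. indicator (B i) x) = real (card {i \<in> I. x \<in> B i})"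
      using \<open>finite I\<close> by (simp add: indicator_def sum.If_cases Int_def)
    with mult[of x] show "(\<Sum>i\<in>I. indicator (B i) x) \<le> real m" by simp
  qed simp
  also have "\<dots> = real m * measure M (space M)" by simp
  finally show ?thesis .
qed

section \<open>Shadows and translates under a quasiconformal measure\<close>

locale quasiconformal = visual_group +
  fixes \<mu> :: "'a boundary_point measure" and \<delta> C :: real
  assumes strongly_discrete: "strongly_discrete p G"
    and finite_borel: "finite_borel_measure_on mtopology \<mu>"
    and \<delta>_nonneg: "0 \<le> \<delta>" and C_ge_1: "C \<ge> 1"
    and quasiconformal: "\<And>g A. g \<in> G \<Longrightarrow> A \<in> sets \<mu> \<Longrightarrow>
      ennreal (1 / C) * (\<integral>\<^sup>+\<eta>\<in>A. ennreal (conformal_derivative b p g \<eta> powr \<delta>) \<partial>\<mu>)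
        \<le> emeasure \<mu> (boundary_action g ` A)"
    and nonzero: "measure \<mu> (space \<mu>) > 0"
begin

sublocale finite_measure \<mu>
  using finite_borel by (simp add: finite_borel_measure_on_def)

lemma sets_\<mu>: "sets \<mu> = sigma_sets (gromov_boundary p) {U. openin mtopology U}"
proof -
  have "{U. openin mtopology U} \<subseteq> Pow (gromov_boundary p)"
    using openin_subset[of mtopology] by auto
  then show ?thesis
    using finite_borel by (simp add: finite_borel_measure_on_def sets_measure_of)
qed

lemma space_\<mu>: "space \<mu> = gromov_boundary p"
proof -
  have "sets \<mu> = sets (sigma (gromov_boundary p) {U. openin mtopology U})"
    using finite_borel by (simp add: finite_borel_measure_on_def)
  then have "space \<mu> = space (sigma (gromov_boundary p) {U. openin mtopology U})"
    by (rule sets_eq_imp_space_eq)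
  also have "\<dots> = gromov_boundary p" by (simp add: space_measure_of_conv)
  finally show ?thesis .
qed

lemma closed_shadow_sets: "closed_shadow z x a \<in> sets \<mu>"
proof -
  have "openin mtopology (gromov_boundary p - closed_shadow z x a)"
    using closedin_closure_of[of mtopology "shadow p z x a"] by (simp add: closedin_def)
  then have "gromov_boundary p - (gromov_boundary p - closed_shadow z x a) \<in> sets \<mu>"
    unfolding sets_\<mu> by (intro sigma_sets.Compl sigma_sets.Basic) simp
  moreover have "gromov_boundary p - (gromov_boundary p - closed_shadow z x a) = closed_shadow z x a"
    using closed_shadow_subset_boundary by blast
  ultimately show ?thesis by simp
qed

lemma finite_orbit_ball: "finite {g \<in> G. dist p (g p) \<le> r}"
proof (rule finite_subset)
  show "{g \<in> G. dist p (g p) \<le> r} \<subseteq> {g \<in> G. dist p (g p) \<le> max r 1}" by auto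
  show "finite {g \<in> G. dist p (g p) \<le> max r 1}"
    using strongly_discrete unfolding strongly_discrete_def by (metis less_max_iff_disj zero_less_one)
qed

lemma finite_level: "finite (level N n)"
  by (rule finite_subset[OF _ finite_orbit_ball[of "real n + real N"]]) (auto simp: level_def)

lemma radial_set_sets: "radial_set N \<in> sets \<mu>"
  unfolding radial_set_def
  by (intro sets.countable_INT' sets.finite_UN finite_level closed_shadow_sets image_subsetI) auto

lemma measure_translate_ge:
  assumes g: "g \<in> G" and A: "A \<in> sets \<mu>"
    and t: "\<And>\<eta>. \<eta> \<in> A \<Longrightarrow> t \<le> busemann \<eta> p (iv g p)"
  shows "b powr (\<delta> * t) / C * measure \<mu> A \<le> measure \<mu> (boundary_action g ` A)"
proof -
  have "ennreal (b powr (\<delta> * t) / C * measure \<mu> A) = ennreal (1 / C) * (ennreal (b powr (\<delta> * t)) * emeasure \<mu> A)"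
    using C_ge_1 by (simp add: emeasure_eq_measure ennreal_mult[symmetric] field_simps)
  also have "ennreal (b powr (\<delta> * t)) * emeasure \<mu> A = (\<integral>\<^sup>+\<eta>\<in>A. ennreal (b powr (\<delta> * t)) \<partial>\<mu>)"
    using A by (simp add: nn_integral_cmult_indicator)
  also have "\<dots> \<le> (\<integral>\<^sup>+\<eta>\<in>A. ennreal (conformal_derivative b p g \<eta> powr \<delta>) \<partial>\<mu>)"
  proof (rule nn_integral_mono)
    fix \<eta>
    show "ennreal (b powr (\<delta> * t)) * indicator A \<eta>
        \<le> ennreal (conformal_derivative b p g \<eta> powr \<delta>) * indicator A \<eta>"
    proof (cases "\<eta> \<in> A")
      case True
      have "b powr (\<delta> * t) \<le> b powr (busemann \<eta> p (iv g p) * \<delta>)"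
        using t[OF True] \<delta>_nonneg b_gt_1 by (intro powr_mono) (simp_all add: mult.commute mult_left_mono)
      then show ?thesis using True by (simp add: conformal_derivative_def powr_powr ennreal_leI)
    qed simp
  qed
  also have "ennreal (1 / C) * \<dots> \<le> emeasure \<mu> (boundary_action g ` A)"
    by (rule quasiconformal[OF g A])
  finally show ?thesis
    by (simp add: mult_left_mono emeasure_eq_measure)
qed

text \<open>The upper half of the shadow lemma: \<open>iv g\<close> expands the measure of the
  shadow by a factor of order \<open>b powr (\<delta> * dist p (g p))\<close>, and the image has at
  most the total mass.\<close>

lemma measure_closed_shadow_le:
  assumes g: "g \<in> G"
  shows "measure \<mu> (closed_shadow (g p) p a)
    \<le> C * b powr (\<delta> * (2 * a + 2 * H)) * measure \<mu> (space \<mu>) * b powr (- \<delta> * dist p (g p))"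
proof -
  let ?A = "closed_shadow (g p) p a" and ?d = "dist p (g p)"
  have "b powr (\<delta> * (?d - 2 * a - 2 * H)) / C * measure \<mu> ?A \<le> measure \<mu> (boundary_action (iv g) ` ?A)"
    by (rule measure_translate_ge[OF G_inv[OF g] closed_shadow_sets])
      (simp add: iv_iv[OF g] busemann_closed_shadow)
  also have "\<dots> \<le> measure \<mu> (space \<mu>)" by (rule bounded_measure)
  finally have "b powr (\<delta> * (?d - 2 * a - 2 * H)) * measure \<mu> ?A \<le> C * measure \<mu> (space \<mu>)"
    using C_ge_1 by (simp add: field_simps)
  then have "measure \<mu> ?A \<le> C * measure \<mu> (space \<mu>) / b powr (\<delta> * (?d - 2 * a - 2 * H))"
    using b_gt_1 by (simp add: field_simps)
  also have "\<dots> = C * measure \<mu> (space \<mu>) * b powr (- (\<delta> * (?d - 2 * a - 2 * H)))"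
    by (simp add: powr_minus_divide)
  also have "- (\<delta> * (?d - 2 * a - 2 * H)) = \<delta> * (2 * a + 2 * H) + - \<delta> * ?d"
    by (simp add: algebra_simps)
  finally show ?thesis by (simp only: powr_add mult_ac)
qed

text \<open>These finitely many shadows cover the boundary, so they cannot all be null.\<close>

lemma exists_positive_shadow:
  assumes F: "F \<subseteq> G" "finite F" and A: "\<And>x y. \<exists>f\<in>F. gromov_product p x (f y) \<le> A"
  shows "\<exists>f\<in>F. 0 < measure \<mu> (closed_shadow (iv f p) (iv f x) A)"
proof (rule ccontr)
  assume "\<not> ?thesis"
  then have "measure \<mu> (closed_shadow (iv f p) (iv f x) A) = 0" if "f \<in> F" for f
    using that by (metis less_eq_real_def measure_nonneg)
  then have "(\<Union>f\<in>F. closed_shadow (iv f p) (iv f x) A) \<in> null_sets \<mu>"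
    using F(2) by (intro null_sets_UN' countable_finite) (auto simp: null_sets_def emeasure_eq_measure closed_shadow_sets)
  moreover have "space \<mu> \<subseteq> (\<Union>f\<in>F. closed_shadow (iv f p) (iv f x) A)"
  proof
    fix \<zeta> assume "\<zeta> \<in> space \<mu>"
    then have \<zeta>: "\<zeta> \<in> gromov_boundary p" by (simp add: space_\<mu>)
    then obtain w where w: "w \<in> \<zeta>" using gromov_boundary_nonempty by blast
    \<comment> \<open>Pigeonhole: each \<open>k\<close> has a suitable \<open>f\<close>, and
      \<open>F\<close> is finite, so one \<open>f\<close> serves infinitely many
      \<open>k\<close>.\<close>
    have "\<exists>f\<in>F. \<exists>\<^sub>F k in sequentially. gromov_product p x (f (w k)) \<le> A"
    proof (rule ccontr)
      assume "\<not> ?thesis"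
      then have "\<forall>\<^sub>F k in sequentially. \<forall>f\<in>F. \<not> gromov_product p x (f (w k)) \<le> A"
        using F(2) by (auto simp: not_frequently intro!: eventually_ball_finite)
      then obtain k where "\<forall>f\<in>F. \<not> gromov_product p x (f (w k)) \<le> A"
        unfolding eventually_sequentially by blast
      with A show False by blast
    qed
    then obtain f where f: "f \<in> F" "\<exists>\<^sub>F k in sequentially. gromov_product p x (f (w k)) \<le> A" by blast
    have fG: "f \<in> G" using f(1) F(1) by blast
    have "gromov_product (iv f p) (iv f x) (w k) = gromov_product p x (f (w k))" for k
      using G_gromov_product[OF fG, of "iv f p" "iv f x" "w k"] by (simp add: apply_iv[OF fG])
    then have "\<zeta> \<in> shadow p (iv f p) (iv f x) A" using \<zeta> w f(2) by (auto simp: shadow_def intro!: bexI[of _ w])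
    then show "\<zeta> \<in> (\<Union>f\<in>F. closed_shadow (iv f p) (iv f x) A)"
      using f(1) shadow_subset_closed_shadow by blast
  qed
  ultimately have "measure \<mu> (space \<mu>) = 0"
    by (meson measure_eq_0_null_sets null_sets_subset sets.top)
  with nonzero show False by simp
qed

text \<open>A geodesic between orbit points with a point far from the orbit is translated to start
  at \<open>p\<close>; the vanishing product records that \<open>z\<close> lies on it.\<close>

lemma not_quasiconvexD:
  assumes "\<not> quasiconvex_cocompact p G" "R > 0"
  obtains h z where "h \<in> G" "gromov_product z p (h p) = 0" "\<And>u. u \<in> G \<Longrightarrow> R \<le> dist z (u p)"
proof -
  from assms obtain x y \<gamma> where xy: "x \<in> (\<lambda>g. g p) ` G" "y \<in> (\<lambda>g. g p) ` G" "geodesic_segment \<gamma> x y"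
      "\<not> \<gamma> ` {0..dist x y} \<subseteq> (\<Union>z\<in>(\<lambda>g. g p) ` G. ball z R)"
    unfolding quasiconvex_cocompact_def by meson
  then obtain g1 g2 t where g: "g1 \<in> G" "g2 \<in> G" "x = g1 p" "y = g2 p" and t: "t \<in> {0..dist x y}"
      "\<gamma> t \<notin> (\<Union>z\<in>(\<lambda>g. g p) ` G. ball z R)"
    by blast
  have "dist x (\<gamma> t) = t" "dist (\<gamma> t) y = dist x y - t"
    using xy(3) t(1) unfolding geodesic_segment_def
    by (metis abs_minus_commute abs_of_nonneg atLeastAtMost_iff diff_zero dist_commute order_refl zero_le_dist,
        metis abs_minus_commute abs_of_nonneg atLeastAtMost_iff diff_ge_0_iff_ge order_refl zero_le_dist)
  then have "gromov_product (\<gamma> t) x y = 0"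
    by (simp add: gromov_product_def dist_commute)
  then have "gromov_product (iv g1 (\<gamma> t)) p ((iv g1 \<circ> g2) p) = 0"
    using G_gromov_product[OF G_inv[OF g(1)], of "\<gamma> t" x y] by (simp add: g iv_apply)
  moreover have "R \<le> dist (iv g1 (\<gamma> t)) (u p)" if "u \<in> G" for u
  proof -
    have "g1 \<circ> u \<in> G" using g(1) that by (rule G_comp)
    then have "R \<le> dist ((g1 \<circ> u) p) (\<gamma> t)" using t(2) by (auto simp: not_less)
    then show ?thesis using dist_iv[OF g(1), of "u p" "\<gamma> t"] by (simp add: dist_commute)
  qed
  ultimately show thesis using that G_comp[OF G_inv[OF g(1)] g(2)] by blast
qed

end

section \<open>Detour sets and the vanishing of the radial sets\<close>

context quasiconformal
begin

text \<open>\<open>B g\<close> is a shadow, as seen from \<open>g p\<close>, of a path that leaves the orbit; the middle piece of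
  \<open>g f h f' \<zeta>\<close> is the excursion, and \<open>f, f' \<in> F\<close> only prevent backtracking at \<open>p\<close> and at \<open>f h p\<close>.\<close>

lemma exists_detours:
  assumes F: "F \<subseteq> G" "finite F" "F \<noteq> {}" and "0 \<le> A"
    and A: "\<And>x y. \<exists>f\<in>F. gromov_product p x (f y) \<le> A"
    and nqc: "\<not> quasiconvex_cocompact p G"
  shows "\<exists>a\<ge>0. \<forall>R. \<exists>B Z P c. c > 0 \<and> (\<forall>g\<in>G. B g \<in> sets \<mu> \<and> B g \<subseteq> closed_shadow (Z g) p a \<and>
      c * b powr (- \<delta> * dist p (g p)) \<le> measure \<mu> (B g) \<and> dist (Z g) (g p) \<le> P \<and>
      (\<forall>u\<in>G. R \<le> dist (Z g) (u p)))"
proof -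
  define L where "L = Max ((\<lambda>f. dist p (f p)) ` F)"
  have L: "dist p (f p) \<le> L" if "f \<in> F" for f
    unfolding L_def using F(2) that by (intro Max_ge) auto
  have "0 \<le> L" using L F(3) by (meson all_not_in_conv order_trans zero_le_dist)
  show ?thesis
  \<comment> \<open>The error \<open>a\<close> is fixed before \<open>R\<close>, so that
    \<open>R\<close> can later be chosen large in terms of \<open>a\<close>.\<close>
  proof (intro exI[of _ "L + 2 * H"] conjI allI)
    show "0 \<le> L + 2 * H" using \<open>0 \<le> L\<close> H_nonneg by simp
    fix R :: real
    \<comment> \<open>The second term is what \<open>passes_near_detour\<close> requires with
      backtracking bounds \<open>A\<close> and \<open>A + H\<close>.\<close>
    define R' where "R' = max R (L + A + (A + H) + 3 * H + 1)"
    have "R' > 0" using \<open>0 \<le> L\<close> \<open>0 \<le> A\<close> H_nonneg by (simp add: R'_def)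
    from not_quasiconvexD[OF nqc this] obtain h z where h: "h \<in> G" "gromov_product z p (h p) = 0"
      and far: "\<And>u. u \<in> G \<Longrightarrow> R' \<le> dist z (u p)"
      by blast
    \<comment> \<open>\<open>f h\<close> sends \<open>x f\<close> to \<open>p\<close>. Hence
      \<open>T f f'\<close> collects the \<open>\<zeta>\<close> for which the path from
      \<open>p\<close> via \<open>f h p\<close> to \<open>f h f' \<zeta>\<close> does not backtrack
      at \<open>f h p\<close>.\<close>
    define x where "x f = iv (f \<circ> h) p" for f
    define T where "T f f' = closed_shadow (iv f' p) (iv f' (x f)) A" for f f'
    have "\<exists>f'\<in>F. 0 < measure \<mu> (T f f')" for f
      unfolding T_def by (rule exists_positive_shadow[OF F(1,2) A])
    then obtain s where s: "\<And>f. s f \<in> F" "\<And>f. 0 < measure \<mu> (T f (s f))" by metis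
    \<comment> \<open>In coordinates translated by \<open>iv g\<close>, the path from
      \<open>iv g p\<close> to \<open>p\<close> continues to \<open>f h p\<close> without
      backtracking at \<open>p\<close>.\<close>
    have "\<exists>f\<in>F. gromov_product p (iv g p) (f (h p)) \<le> A" for g by (rule A)
    then obtain q where q: "\<And>g. q g \<in> F" "\<And>g. gromov_product p (iv g p) (q g (h p)) \<le> A" by metis
    define e where "e f = f \<circ> h \<circ> s f" for f
    define B where "B g = boundary_action (g \<circ> e (q g)) ` T (q g) (s (q g))" for g
    define Z where "Z g = g (q g z)" for g
    \<comment> \<open>Only finitely many pieces \<open>e f\<close> and \<open>T f (s f)\<close>
      occur, so one positive constant serves all \<open>g\<close>.\<close>
    define c where "c = Min ((\<lambda>f. b powr (- \<delta> * dist p (e f p)) / C * measure \<mu> (T f (s f))) ` F)"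
    have "c > 0"
      unfolding c_def using F(2,3) s(2) b_gt_1 C_ge_1 by (subst Min_gr_iff) auto
    moreover have "B g \<in> sets \<mu> \<and> B g \<subseteq> closed_shadow (Z g) p (L + 2 * H) \<and>
        c * b powr (- \<delta> * dist p (g p)) \<le> measure \<mu> (B g) \<and> dist (Z g) (g p) \<le> L + dist p z \<and>
        (\<forall>u\<in>G. R \<le> dist (Z g) (u p))" if g: "g \<in> G" for g
    proof -
      let ?f = "q g"
      let ?f' = "s ?f"
      let ?T = "T ?f ?f'"
      let ?v = "g \<circ> e ?f"
      have fG: "?f \<in> G" "?f' \<in> G" using q(1) s(1) F(1) by auto
      have fh: "?f \<circ> h \<in> G" and eG: "e ?f \<in> G" and vG: "?v \<in> G"
        using G_comp g fG h(1) by (auto simp: e_def)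
      have T_sets: "?T \<in> sets \<mu>" by (simp add: T_def closed_shadow_sets)
      have "c \<le> b powr (- \<delta> * dist p (e ?f p)) / C * measure \<mu> ?T"
        unfolding c_def using F(2) q(1) by (intro Min_le) auto
      then have "c * b powr (- \<delta> * dist p (g p))
          \<le> b powr (- \<delta> * dist p (e ?f p)) / C * measure \<mu> ?T * b powr (- \<delta> * dist p (g p))"
        by (rule mult_right_mono) simp
      also have "\<dots> = b powr (\<delta> * - (dist p (e ?f p) + dist p (g p))) / C * measure \<mu> ?T"
        by (simp add: powr_add[symmetric] algebra_simps)
      also have "\<dots> \<le> b powr (\<delta> * - dist p (iv ?v p)) / C * measure \<mu> ?T"
      proof (intro mult_right_mono divide_right_mono powr_mono mult_left_mono)
        have "dist p (iv ?v p) = dist (?v p) p" by (rule dist_iv[OF vG])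
        also have "\<dots> \<le> dist p (e ?f p) + dist p (g p)"
          using dist_triangle[of "?v p" p "g p"] G_dist[OF g, of "e ?f p" p] by (simp add: dist_commute)
        finally show "- (dist p (e ?f p) + dist p (g p)) \<le> - dist p (iv ?v p)" by simp
      qed (use b_gt_1 C_ge_1 \<delta>_nonneg in auto)
      also have "\<dots> \<le> measure \<mu> (B g)"
        unfolding B_def
      proof (rule measure_translate_ge[OF vG T_sets])
        fix \<eta> assume "\<eta> \<in> ?T"
        then have "\<eta> \<in> gromov_boundary p"
          unfolding T_def using closed_shadow_subset_boundary by blast
        then show "- dist p (iv ?v p) \<le> busemann \<eta> p (iv ?v p)" by (rule busemann_ge_neg_dist)
      qed
      finally have ge: "c * b powr (- \<delta> * dist p (g p)) \<le> measure \<mu> (B g)" .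
      moreover have "0 < c * b powr (- \<delta> * dist p (g p))" using \<open>c > 0\<close> b_gt_1 by simp
      \<comment> \<open>\<open>measure\<close> is 0 on nonmeasurable sets, so positivity yields the
        measurability of the image \<open>B g\<close>.\<close>
      ultimately have "measure \<mu> (B g) \<noteq> 0" by linarith
      then have B_sets: "B g \<in> sets \<mu>" using measure_notin_sets by blast
      have Z_far: "R' \<le> dist (Z g) (u p)" if "u \<in> G" for u
      proof -
        have gf: "g \<circ> ?f \<in> G" using g fG(1) by (rule G_comp)
        have "R' \<le> dist z ((iv (g \<circ> ?f) \<circ> u) p)" using far G_comp G_inv[OF gf] that by blast
        then show ?thesis using dist_iv[OF gf, of z "u p"] by (simp add: Z_def)
      qed
      have "B g \<subseteq> shadow p (Z g) p (L + 2 * H)"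
      proof
        fix \<eta> assume \<eta>: "\<eta> \<in> B g"
        then obtain \<zeta> where \<zeta>: "\<zeta> \<in> ?T" "\<eta> = boundary_action ?v \<zeta>" by (auto simp: B_def)
        have \<eta>b: "\<eta> \<in> gromov_boundary p" using \<eta> sets.sets_into_space[OF B_sets] space_\<mu> by blast
        have "\<zeta> \<in> gromov_boundary p"
          using \<zeta>(1) closed_shadow_subset_boundary unfolding T_def by blast
        then obtain w where w: "w \<in> \<zeta>" using gromov_boundary_nonempty by blast
        have "\<forall>\<^sub>F k in sequentially. gromov_product (Z g) p ((?v \<circ> w) k) \<le> L + 2 * H"
          using closed_shadow_eventually[OF \<zeta>(1)[unfolded T_def] w]
        proof eventually_elim
          case (elim k)
          let ?y = "e ?f (w k)"
          have "gromov_product (?f (h p)) p ?y = gromov_product (iv ?f' p) (iv ?f' (x ?f)) (w k)"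
            using G_gromov_product[OF eG, of "iv ?f' p" "iv ?f' (x ?f)" "w k"] apply_iv[OF fh, of p]
            by (simp add: e_def x_def apply_iv[OF fG(2)])
          then have y: "gromov_product (?f (h p)) p ?y \<le> A + H" using elim by simp
          \<comment> \<open>The excursion runs from \<open>f p\<close> to \<open>f h p\<close>
            through \<open>f z\<close>; starting at \<open>p\<close> instead of \<open>f p\<close>
            costs at most \<open>L\<close>.\<close>
          have "gromov_product (?f z) (iv g p) ?y \<le> L + 2 * H"
          proof (rule passes_near_detour)
            show "dist p (?f p) \<le> L" using L q(1) .
            show "gromov_product (?f z) (?f p) (?f (h p)) \<le> 0"
              using h(2) G_gromov_product[OF fG(1)] by simp
            show "gromov_product p (iv g p) (?f (h p)) \<le> A" by (rule q(2))
            show "gromov_product (?f (h p)) p ?y \<le> A + H" by (rule y)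
            have "dist (?f z) p = dist z (iv ?f p)" by (simp add: dist_iv[OF fG(1)])
            then show "R' \<le> dist (?f z) p" using far[OF G_inv[OF fG(1)]] by simp
            show "R' \<le> dist (?f z) (?f (h p))" using far[OF h(1)] by (simp add: G_dist[OF fG(1)])
            show "L + A + (A + H) + 3 * H < R'" by (simp add: R'_def)
          qed (use \<open>0 \<le> A\<close> H_nonneg in auto)
          then show ?case
            using G_gromov_product[OF g, of "?f z" "iv g p" ?y] by (simp add: Z_def apply_iv[OF g])
        qed
        moreover have "?v \<circ> w \<in> \<eta>" using \<zeta>(2) w by (auto simp: boundary_action_def)
        ultimately show "\<eta> \<in> shadow p (Z g) p (L + 2 * H)"
          using \<eta>b eventually_frequently[OF sequentially_bot] unfolding shadow_def by blast
      qed
      then have "B g \<subseteq> closed_shadow (Z g) p (L + 2 * H)"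
        using shadow_subset_closed_shadow by blast
      moreover have "dist (Z g) (g p) \<le> L + dist p z"
        using G_dist[OF g, of "?f z" p] dist_triangle[of "?f z" p "?f p"] G_dist[OF fG(1), of z p] L[OF q(1)[of g]]
        by (simp add: Z_def dist_commute)
      moreover have "R \<le> dist (Z g) (u p)" if "u \<in> G" for u
        using Z_far[OF that] by (simp add: R'_def)
      ultimately show ?thesis using B_sets ge by blast
    qed
    ultimately show "\<exists>B Z P c. c > 0 \<and> (\<forall>g\<in>G. B g \<in> sets \<mu> \<and> B g \<subseteq> closed_shadow (Z g) p (L + 2 * H) \<and>
      c * b powr (- \<delta> * dist p (g p)) \<le> measure \<mu> (B g) \<and> dist (Z g) (g p) \<le> P \<and>
      (\<forall>u\<in>G. R \<le> dist (Z g) (u p)))"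
      by (intro exI[of _ B] exI[of _ Z] exI[of _ "L + dist p z"] exI[of _ c]) blast
  qed
qed

lemma measure_radial_set_eq_0:
  assumes F: "F \<subseteq> G" "finite F" "F \<noteq> {}" and "0 \<le> A"
    and A: "\<And>x y. \<exists>f\<in>F. gromov_product p x (f y) \<le> A"
    and nqc: "\<not> quasiconvex_cocompact p G"
  shows "measure \<mu> (radial_set N) = 0"
proof -
  obtain a where "a \<ge> 0" and detours: "\<And>R. \<exists>B Z P c. c > 0 \<and> (\<forall>g\<in>G. B g \<in> sets \<mu> \<and>
      B g \<subseteq> closed_shadow (Z g) p a \<and> c * b powr (- \<delta> * dist p (g p)) \<le> measure \<mu> (B g) \<and>
      dist (Z g) (g p) \<le> P \<and> (\<forall>u\<in>G. R \<le> dist (Z g) (u p)))"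
    using exists_detours[OF assms] by blast
  \<comment> \<open>One more than the bound that \<open>close_to_orbit_below_branching\<close> gives
    in the disjointness argument.\<close>
  define R where "R = 3 * real N + 3 + 2 * a + 8 * H"
  obtain B Z P c where "c > 0" and B: "\<And>g. g \<in> G \<Longrightarrow> B g \<in> sets \<mu>"
      "\<And>g. g \<in> G \<Longrightarrow> B g \<subseteq> closed_shadow (Z g) p a"
      "\<And>g. g \<in> G \<Longrightarrow> c * b powr (- \<delta> * dist p (g p)) \<le> measure \<mu> (B g)"
      "\<And>g. g \<in> G \<Longrightarrow> dist (Z g) (g p) \<le> P" "\<And>g u. g \<in> G \<Longrightarrow> u \<in> G \<Longrightarrow> R \<le> dist (Z g) (u p)"
    using detours[of R] by metis
  have "0 \<le> P" using B(4)[OF G_id] zero_le_dist[of "Z id" "id p"] by linarith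
  have ray: "\<forall>\<^sub>F k in sequentially. gromov_product (Z g) p (y k) \<le> a + H \<and>
      gromov_product (g p) p (y k) \<le> a + H + P"
    if "g \<in> G" "\<eta> \<in> B g" "y \<in> \<eta>" for g \<eta> y
    using closed_shadow_eventually[OF subsetD[OF B(2)] that(3), OF that(1,2)]
  proof eventually_elim
    case (elim k)
    then show ?case
      using gromov_product_lipschitz_base[of "g p" p "y k" "Z g"] B(4)[OF that(1)]
      by (simp add: dist_commute)
  qed
  have boundary: "\<eta> \<in> gromov_boundary p" if "g \<in> G" "\<eta> \<in> B g" for g \<eta>
    using B(2)[OF that(1)] that(2) closed_shadow_subset_boundary by blast
  \<comment> \<open>These elements already cover the radial set, and each has a radial point in its
    shadow, which the disjointness argument needs.\<close>
  define lev where "lev n = {g \<in> level N n. closed_shadow (g p) p N \<inter> radial_set N \<noteq> {}}" for n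
  have lev: "g \<in> G" "real n \<le> dist p (g p)" "dist p (g p) \<le> real n + real N" if "g \<in> lev n" for g n
    using that by (auto simp: lev_def level_def)
  have fin: "finite (lev n)" for n
    unfolding lev_def using finite_level by simp
  define U where "U = C * b powr (\<delta> * (2 * real N + 2 * H)) * measure \<mu> (space \<mu>)"
  have "U > 0" unfolding U_def using C_ge_1 b_gt_1 nonzero by simp
  \<comment> \<open>The shadows over \<open>lev n\<close> cover the radial set, and each has measure
    at most \<open>U / c\<close> times that of its detour set.\<close>
  have mass: "c / U * measure \<mu> (radial_set N) \<le> (\<Sum>g\<in>lev n. measure \<mu> (B g))" for n
  proof -
    have "radial_set N \<subseteq> (\<Union>g\<in>lev n. closed_shadow (g p) p N)"
      unfolding lev_def radial_set_def by blast
    then have "measure \<mu> (radial_set N) \<le> measure \<mu> (\<Union>g\<in>lev n. closed_shadow (g p) p N)"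
      using fin by (intro finite_measure_mono sets.finite_UN closed_shadow_sets)
    also have "\<dots> \<le> (\<Sum>g\<in>lev n. measure \<mu> (closed_shadow (g p) p N))"
      using fin by (intro finite_measure_subadditive_finite) (auto simp: closed_shadow_sets)
    also have "\<dots> \<le> (\<Sum>g\<in>lev n. U / c * measure \<mu> (B g))"
    proof (rule sum_mono)
      fix g assume "g \<in> lev n"
      then have g: "g \<in> G" by (rule lev)
      have "measure \<mu> (closed_shadow (g p) p N) \<le> U * b powr (- \<delta> * dist p (g p))"
        unfolding U_def by (rule measure_closed_shadow_le[OF g])
      also have "\<dots> = U / c * (c * b powr (- \<delta> * dist p (g p)))" using \<open>c > 0\<close> by simp
      also have "\<dots> \<le> U / c * measure \<mu> (B g)"
        using B(3)[OF g] \<open>c > 0\<close> \<open>U > 0\<close> by (intro mult_left_mono) auto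
      finally show "measure \<mu> (closed_shadow (g p) p N) \<le> U / c * measure \<mu> (B g)" .
    qed
    also have "\<dots> = U / c * (\<Sum>g\<in>lev n. measure \<mu> (B g))" by (simp add: sum_distrib_left)
    finally show ?thesis using \<open>c > 0\<close> \<open>U > 0\<close> by (simp add: field_simps)
  qed
  \<comment> \<open>\<open>Z g\<close> has height at most \<open>n + N + P\<close>; the gap leaves
    room above it for the errors \<open>a + H + P\<close> and \<open>N + H\<close> at
    \<open>g'\<close>.\<close>
  define m where "m = nat \<lceil>2 * real N + 2 * P + a + 2 * H\<rceil> + 1"
  have m: "2 * real N + 2 * P + a + 2 * H \<le> real m" "m \<ge> 1" unfolding m_def by linarith+
  \<comment> \<open>A common point \<open>\<eta>\<close> puts \<open>Z g\<close> below
    \<open>g'\<close>. The orbit follows the ray to a radial point \<open>\<theta>\<close> over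
    \<open>g'\<close>, so some orbit point \<open>u\<close> at the height of \<open>Z g\<close> is
    closer to it than \<open>R\<close>.\<close>
  have disjoint: "B g \<inter> B g' = {}" if g: "g \<in> lev n" and g': "g' \<in> lev n'" and n: "n + m \<le> n'" for g g' n n'
  proof (rule ccontr)
    assume "B g \<inter> B g' \<noteq> {}"
    then obtain \<eta> where \<eta>: "\<eta> \<in> B g" "\<eta> \<in> B g'" by blast
    obtain y where y: "y \<in> \<eta>" using gromov_boundary_nonempty[OF boundary[OF lev(1)[OF g] \<eta>(1)]] by blast
    obtain \<theta> where \<theta>: "\<theta> \<in> closed_shadow (g' p) p N" "\<theta> \<in> radial_set N" using g' unfolding lev_def by blast
    obtain w where w: "w \<in> \<theta>"
      using \<theta>(1) closed_shadow_subset_boundary gromov_boundary_nonempty by blast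
    define j where "j = nat \<lfloor>dist p (Z g)\<rfloor>"
    have j: "real j \<le> dist p (Z g)" "dist p (Z g) - 1 \<le> real j"
      unfolding j_def using zero_le_dist[of p "Z g"] by linarith+
    obtain u where u: "u \<in> level N j" "\<theta> \<in> closed_shadow (u p) p N"
      using \<theta>(2) unfolding radial_set_def by blast
    have "\<forall>\<^sub>F k in sequentially.
        (gromov_product (Z g) p (y k) \<le> a + H \<and> gromov_product (g p) p (y k) \<le> a + H + P) \<and>
        (gromov_product (Z g') p (y k) \<le> a + H \<and> gromov_product (g' p) p (y k) \<le> a + H + P) \<and>
        gromov_product (g' p) p (w k) \<le> real N + H \<and> gromov_product (u p) p (w k) \<le> real N + H"
      by (intro eventually_conj ray[OF lev(1)[OF g] \<eta>(1) y] ray[OF lev(1)[OF g'] \<eta>(2) y]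
          closed_shadow_eventually[OF \<theta>(1) w] closed_shadow_eventually[OF u(2) w])
    then obtain k where k: "gromov_product (Z g) p (y k) \<le> a + H" "gromov_product (g' p) p (y k) \<le> a + H + P"
        "gromov_product (g' p) p (w k) \<le> real N + H" "gromov_product (u p) p (w k) \<le> real N + H"
      unfolding eventually_sequentially by blast
    have "dist p (Z g) \<le> real n + real N + P"
      using lev(3)[OF g] B(4)[OF lev(1)[OF g]] dist_triangle[of p "Z g" "g p"] by (simp add: dist_commute)
    moreover have "real n + real m \<le> dist p (g' p)" using lev(2)[OF g'] n by linarith
    ultimately have "dist p (Z g) + (a + H + P) + (real N + H) \<le> dist p (g' p)" using m(1) by linarith
    then have "dist (Z g) (u p) \<le> real N + 2 + 2 * (a + H) + 2 * (real N + H) + 4 * H"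
      using j u(1) \<open>0 \<le> a\<close> \<open>0 \<le> P\<close> H_nonneg
      by (intro close_to_orbit_below_branching[OF k]) (auto simp: level_def)
    moreover have "R \<le> dist (Z g) (u p)" using B(5)[OF lev(1)[OF g]] u(1) by (simp add: level_def)
    ultimately show False by (simp add: R_def)
  qed
  \<comment> \<open>Heights within one level differ by at most \<open>N\<close>; the rest comes from
    \<open>dist_le_of_common_ray\<close> with error \<open>a + H + P\<close>.\<close>
  define Q where "Q = real N + 2 * (a + H + P) + 2 * H"
  define M where "M = card {u \<in> G. dist p (u p) \<le> Q}"
  have mult: "card {g \<in> lev n. \<eta> \<in> B g} \<le> M" for n \<eta>
  proof (cases "{g \<in> lev n. \<eta> \<in> B g} = {}")
    case False
    then obtain g where g: "g \<in> lev n" "\<eta> \<in> B g" by blast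
    have gG: "g \<in> G" by (rule lev(1)[OF g(1)])
    obtain y where y: "y \<in> \<eta>" using gromov_boundary_nonempty[OF boundary[OF gG g(2)]] by blast
    \<comment> \<open>Translation by \<open>iv g\<close> embeds the competing elements into an orbit
      ball whose size depends on neither \<open>n\<close> nor \<open>\<eta>\<close>.\<close>
    have "inj_on (\<lambda>g'. iv g \<circ> g') {g' \<in> lev n. \<eta> \<in> B g'}"
    proof (rule inj_onI)
      fix g1 g2 assume "iv g \<circ> g1 = iv g \<circ> g2"
      then have "g (iv g (g1 x)) = g (iv g (g2 x))" for x by (metis comp_apply)
      then show "g1 = g2" by (simp add: apply_iv[OF gG] fun_eq_iff)
    qed
    moreover have "(\<lambda>g'. iv g \<circ> g') ` {g' \<in> lev n. \<eta> \<in> B g'} \<subseteq> {u \<in> G. dist p (u p) \<le> Q}"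
    proof (rule image_subsetI)
      fix g' assume "g' \<in> {g' \<in> lev n. \<eta> \<in> B g'}"
      then have g': "g' \<in> lev n" "\<eta> \<in> B g'" by auto
      have "\<forall>\<^sub>F k in sequentially. (gromov_product (Z g) p (y k) \<le> a + H \<and> gromov_product (g p) p (y k) \<le> a + H + P) \<and>
         (gromov_product (Z g') p (y k) \<le> a + H \<and> gromov_product (g' p) p (y k) \<le> a + H + P)"
        by (intro eventually_conj ray[OF gG g(2) y] ray[OF lev(1)[OF g'(1)] g'(2) y])
      then obtain k where "gromov_product (g p) p (y k) \<le> a + H + P" "gromov_product (g' p) p (y k) \<le> a + H + P"
        unfolding eventually_sequentially by blast
      from dist_le_of_common_ray[OF this] have "dist (g p) (g' p) \<le> Q"
        using lev(2,3)[OF g(1)] lev(2,3)[OF g'(1)] by (simp add: Q_def abs_if split: if_splits)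
      then show "iv g \<circ> g' \<in> {u \<in> G. dist p (u p) \<le> Q}"
        using G_comp[OF G_inv[OF gG] lev(1)[OF g'(1)]] dist_iv[OF gG, of p "g' p"] by simp
    qed
    ultimately show ?thesis
      unfolding M_def by (rule card_inj_on_le[OF _ _ finite_orbit_ball])
  qed (simp only: card.empty le0)
  have bound: "real J * (c / U * measure \<mu> (radial_set N)) \<le> real M * measure \<mu> (space \<mu>)" for J
  proof -
    \<comment> \<open>Only heights that are multiples of \<open>m\<close> are used, so all detour
      sets containing a given point come from one height.\<close>
    let ?I = "Sigma {..<J} (\<lambda>j. lev (j * m))"
    have "real J * (c / U * measure \<mu> (radial_set N)) \<le> (\<Sum>j<J. \<Sum>g\<in>lev (j * m). measure \<mu> (B g))"
      using sum_bounded_below[of "{..<J}" "c / U * measure \<mu> (radial_set N)"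
          "\<lambda>j. \<Sum>g\<in>lev (j * m). measure \<mu> (B g)"] mass by simp
    also have "\<dots> = (\<Sum>i\<in>?I. measure \<mu> (B (snd i)))"
      using fin by (simp add: sum.Sigma split_beta)
    also have "\<dots> \<le> real M * measure \<mu> (space \<mu>)"
    proof (rule sum_measure_le_multiplicity)
      show "finite ?I" using fin by auto
      show "B (snd i) \<in> sets \<mu>" if "i \<in> ?I" for i using that B(1) lev(1) by auto
      fix \<eta>
      show "card {i \<in> ?I. \<eta> \<in> B (snd i)} \<le> M"
      proof (cases "{i \<in> ?I. \<eta> \<in> B (snd i)} = {}")
        case False
        then obtain j0 g0 where g0: "g0 \<in> lev (j0 * m)" "\<eta> \<in> B g0" by auto
        have "{i \<in> ?I. \<eta> \<in> B (snd i)} \<subseteq> Pair j0 ` {g \<in> lev (j0 * m). \<eta> \<in> B g}"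
        proof
          fix i assume "i \<in> {i \<in> ?I. \<eta> \<in> B (snd i)}"
          then obtain j g where i: "i = (j, g)" "g \<in> lev (j * m)" "\<eta> \<in> B g" by auto
          have gap: "j * m + m \<le> j' * m" if "j < j'" for j j' :: nat
            using mult_le_mono1[OF Suc_leI[OF that], of m] by simp
          have "j = j0"
          proof (rule ccontr)
            assume "j \<noteq> j0"
            then consider "j < j0" | "j0 < j" by linarith
            then show False
              using disjoint[OF i(2) g0(1) gap] disjoint[OF g0(1) i(2) gap] i(3) g0(2) by cases blast+
          qed
          with i show "i \<in> Pair j0 ` {g \<in> lev (j0 * m). \<eta> \<in> B g}" by blast
        qed
        then have "card {i \<in> ?I. \<eta> \<in> B (snd i)} \<le> card (Pair j0 ` {g \<in> lev (j0 * m). \<eta> \<in> B g})"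
          using fin by (intro card_mono) auto
        also have "\<dots> \<le> M" using mult[of "j0 * m" \<eta>] by (simp add: card_image inj_on_def)
        finally show ?thesis .
      qed (simp only: card.empty le0)
    qed
    finally show ?thesis .
  qed
  show ?thesis
  proof (rule ccontr)
    assume "measure \<mu> (radial_set N) \<noteq> 0"
    then have "0 < c / U * measure \<mu> (radial_set N)"
      using \<open>c > 0\<close> \<open>U > 0\<close> by (simp add: less_le)
    then obtain J where "real M * measure \<mu> (space \<mu>) < real J * (c / U * measure \<mu> (radial_set N))"
      using reals_Archimedean3 by blast
    with bound[of J] show False by simp
  qed
qed

end

section \<open>Quasiconvexity versus nullity of the uniformly radial limit set\<close>

theorem proposition8p17:
  fixes p :: "'a::metric_space"
    and b \<delta> :: real
    and D :: "'a boundary_point \<Rightarrow> 'a boundary_point \<Rightarrow> real"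
    and G :: "('a \<Rightarrow> 'a) set"
    and \<mu> :: "'a boundary_point measure"
  assumes "proper_metric TYPE('a)"
    and "geodesic_metric TYPE('a)"
    and "gromov_hyperbolic TYPE('a)"
    and "b > 1"
    and "visual_metric b p D"
    and "subgroup G isometry_group"
    and "strongly_discrete p G"
    and "general_type p D G"
    and "poincare_exponent b p G = ereal \<delta>"
    and "finite_borel_measure_on (boundary_topology p D) \<mu>"
    and "gromov_boundary p - limit_set p G \<in> null_sets \<mu>"
    and "emeasure \<mu> (space \<mu>) \<noteq> 0"
    and "quasiconformal_measure b p G \<delta> \<mu>"
  shows "uniformly_radial_limit_set p G \<in> null_sets \<mu> \<longleftrightarrow> \<not> quasiconvex_cocompact p G"
proof -
  obtain H where H: "0 \<le> H" "\<And>x y z w :: 'a.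
      min (gromov_product w x y) (gromov_product w y z) - H \<le> gromov_product w x z"
    using assms(3) unfolding gromov_hyperbolic_def by blast
  interpret visual_group p H b D G
    by (intro visual_group.intro visual_boundary.intro visual_group_axioms.intro) (fact H assms)+
  obtain C where C: "C \<ge> 1" "\<And>g A. g \<in> G \<Longrightarrow> A \<in> sets \<mu> \<Longrightarrow>
      ennreal (1 / C) * (\<integral>\<^sup>+\<eta>\<in>A. ennreal (conformal_derivative b p g \<eta> powr \<delta>) \<partial>\<mu>)
        \<le> emeasure \<mu> (boundary_action g ` A)"
    using assms(13) unfolding quasiconformal_measure_def by blast
  have "0 \<le> poincare_exponent b p G"
    unfolding poincare_exponent_def by (rule Inf_greatest) auto
  then have "0 \<le> \<delta>" using assms(9) by simp
  interpret \<mu>: finite_measure \<mu> using assms(10) by (simp add: finite_borel_measure_on_def)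
  have "0 < measure \<mu> (space \<mu>)"
    using assms(12) by (simp add: \<mu>.emeasure_eq_measure less_le)
  interpret quasiconformal p H b D G \<mu> \<delta> C
    by unfold_locales (fact assms C \<open>0 \<le> \<delta>\<close> \<open>0 < measure \<mu> (space \<mu>)\<close>)+
  show ?thesis
  proof
    assume null: "uniformly_radial_limit_set p G \<in> null_sets \<mu>"
    show "\<not> quasiconvex_cocompact p G"
    proof
      assume "quasiconvex_cocompact p G"
      then have "limit_set p G \<subseteq> uniformly_radial_limit_set p G"
        by (rule limit_set_subset_uniformly_radial[OF assms(2)])
      then have "space \<mu> \<subseteq> uniformly_radial_limit_set p G \<union> (gromov_boundary p - limit_set p G)"
        unfolding space_\<mu> by blast
      moreover have "uniformly_radial_limit_set p G \<union> (gromov_boundary p - limit_set p G) \<in> null_sets \<mu>"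
        using null assms(11) by (rule null_sets.Un)
      ultimately have "space \<mu> \<in> null_sets \<mu>"
        by (meson null_sets_subset sets.top)
      with assms(12) show False by auto
    qed
  next
    assume nqc: "\<not> quasiconvex_cocompact p G"
    \<comment> \<open>General type supplies two elements without a common boundary fixed
      point.\<close>
    obtain f1 f2 where f: "f1 \<in> G" "f2 \<in> G" "boundary_fixed_points p f1 \<inter> boundary_fixed_points p f2 = {}"
      using assms(8) unfolding general_type_def by blast
    obtain A where A: "A \<ge> 0" "\<And>x y. \<exists>f\<in>{id, f1, f2}. gromov_product p x (f y) \<le> A"
      using uniformly_transverse[OF assms(1,2) f] by blast
    have "{id, f1, f2} \<subseteq> G" using f G_id by simp
    then have "measure \<mu> (radial_set N) = 0" for N
      using measure_radial_set_eq_0[OF _ _ _ A nqc] by simp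
    then have "radial_set N \<in> null_sets \<mu>" for N
      using radial_set_sets by (simp add: null_sets_def \<mu>.emeasure_eq_measure)
    then show "uniformly_radial_limit_set p G \<in> null_sets \<mu>"
      unfolding uniformly_radial_eq by (intro null_sets_UN)
  qed
qed

end
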